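(* Let $G$ be a finitely generated group of orientation-preserving $C^2$ circle diffeomorphisms. Then any conformal measure of exponent $\delta\le1$ for $G$ which has no atomic part and which is supported on an infinite minimal invariant set is conservative.
   Context: All measures are probability measures. A Riemannian metric on $S^1$ is fixed and $g'(x)>0$ is the derivative with respect to it. A measure $\mu$ on $S^1$ is conformal with exponent $\delta$ ($\delta$-conformal) for $G$ if $\mu(g(B))=\int_B (g'(x))^{\delta}\,d\mu(x)$ for every Borel set $B$ and every $g\in G$. A minimal invariant set is a nonempty closed $G$-invariant subset of $S^1$ minimal for inclusion among such sets; $\mu$ is supported on $\Lambda$ if $\mu(S^1\setminus\Lambda)=0$. The measure $\mu$ (quasi-invariant under $G$) is conservative if for every measurable set $A$ with $\mu(A)>0$ there exists $g\in G\setminus\{e\}$ such that $\mu(A\cap g(A))>0$. *)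

theory Defs
  imports "HOL-Probability.Probability" "HOL-Algebra.Bij" "HOL-Algebra.Generated_Groups"
begin

abbreviation unit_circle :: "complex set" where
  "unit_circle \<equiv> sphere 0 1"

primrec C_k :: "nat \<Rightarrow> (real \<Rightarrow> 'a::real_normed_vector) \<Rightarrow> bool" where
  "C_k 0 h = continuous_on UNIV h"
| "C_k (Suc k) h = (\<exists>h'. (\<forall>t. (h has_vector_derivative h' t) (at t)) \<and> C_k k h')"

text \<open>Smoothness on the circle is tested through \<^term>\<open>cis\<close>, whose restrictions to short
  intervals are the inverses of the standard charts. For maps into the circle, which is an
  embedded submanifold of the plane, this is the usual notion.\<close>

definition circle_C_k :: "nat \<Rightarrow> (complex \<Rightarrow> 'a::real_normed_vector) \<Rightarrow> bool" where
  "circle_C_k k f \<longleftrightarrow> C_k k (\<lambda>t. f (cis t))"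

text \<open>The unit tangent vector at \<open>z\<close>, in the positive direction, is \<open>\<i> z\<close>. The differential of
  \<open>g\<close> at \<open>z\<close> maps it to a real multiple of \<open>\<i> g(z)\<close>; the factor is the signed derivative of
  \<open>g\<close> with respect to arc length.\<close>

definition angular_deriv :: "(complex \<Rightarrow> complex) \<Rightarrow> complex \<Rightarrow> real" where
  "angular_deriv g z = Re (vector_derivative (\<lambda>s. g (z * cis s)) (at 0) / (\<i> * g z))"

definition orientation_preserving_C2_diffeo :: "(complex \<Rightarrow> complex) \<Rightarrow> bool" where
  "orientation_preserving_C2_diffeo g \<longleftrightarrow>
     bij_betw g unit_circle unit_circle \<and>
     circle_C_k 2 g \<and> circle_C_k 2 (inv_into unit_circle g) \<and>
     (\<forall>z\<in>unit_circle. 0 < angular_deriv g z)"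

text \<open>A Riemannian metric on the circle is given by the length \<open>\<rho> z\<close> it assigns to the tangent
  vector \<open>\<i> z\<close>.\<close>

definition riemannian_metric :: "(complex \<Rightarrow> real) \<Rightarrow> bool" where
  "riemannian_metric \<rho> \<longleftrightarrow> (\<forall>z\<in>unit_circle. 0 < \<rho> z) \<and> (\<forall>k. circle_C_k k \<rho>)"

definition metric_deriv :: "(complex \<Rightarrow> real) \<Rightarrow> (complex \<Rightarrow> complex) \<Rightarrow> complex \<Rightarrow> real" where
  "metric_deriv \<rho> g z = \<rho> (g z) * angular_deriv g z / \<rho> z"

text \<open>Elements of \<^term>\<open>BijGroup unit_circle\<close> are extensional, so two of them are equal as soon as
  they agree on the circle.\<close>

definition C2_diffeo_group :: "(complex \<Rightarrow> complex) set \<Rightarrow> bool" where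
  "C2_diffeo_group G \<longleftrightarrow>
     subgroup G (BijGroup unit_circle) \<and> (\<forall>g\<in>G. orientation_preserving_C2_diffeo g)"

definition finitely_generated :: "(complex \<Rightarrow> complex) set \<Rightarrow> bool" where
  "finitely_generated G \<longleftrightarrow>
     (\<exists>S. finite S \<and> S \<subseteq> G \<and> generate (BijGroup unit_circle) S = G)"

definition circle_probability :: "complex measure \<Rightarrow> bool" where
  "circle_probability \<mu> \<longleftrightarrow> prob_space \<mu> \<and> sets \<mu> = sets (restrict_space borel unit_circle)"

definition conformal_measure ::
  "(complex \<Rightarrow> real) \<Rightarrow> (complex \<Rightarrow> complex) set \<Rightarrow> real \<Rightarrow> complex measure \<Rightarrow> bool" where
  "conformal_measure \<rho> G \<delta> \<mu> \<longleftrightarrow>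
     circle_probability \<mu> \<and>
     (\<forall>g\<in>G. \<forall>B\<in>sets \<mu>.
        emeasure \<mu> (g ` B) = (\<integral>\<^sup>+x\<in>B. ennreal (metric_deriv \<rho> g x powr \<delta>) \<partial>\<mu>))"

definition closed_invariant :: "(complex \<Rightarrow> complex) set \<Rightarrow> complex set \<Rightarrow> bool" where
  "closed_invariant G K \<longleftrightarrow>
     K \<noteq> {} \<and> K \<subseteq> unit_circle \<and> closed K \<and> (\<forall>g\<in>G. g ` K = K)"

definition minimal_invariant :: "(complex \<Rightarrow> complex) set \<Rightarrow> complex set \<Rightarrow> bool" where
  "minimal_invariant G \<Lambda> \<longleftrightarrow>
     closed_invariant G \<Lambda> \<and> (\<forall>K. closed_invariant G K \<and> K \<subseteq> \<Lambda> \<longrightarrow> K = \<Lambda>)"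

definition supported_on :: "complex measure \<Rightarrow> complex set \<Rightarrow> bool" where
  "supported_on \<mu> \<Lambda> \<longleftrightarrow> emeasure \<mu> (unit_circle - \<Lambda>) = 0"

definition no_atoms :: "complex measure \<Rightarrow> bool" where
  "no_atoms \<mu> \<longleftrightarrow> (\<forall>x\<in>unit_circle. emeasure \<mu> {x} = 0)"

definition conservative :: "(complex \<Rightarrow> complex) set \<Rightarrow> complex measure \<Rightarrow> bool" where
  "conservative G \<mu> \<longleftrightarrow>
     (\<forall>A\<in>sets \<mu>. emeasure \<mu> A > 0 \<longrightarrow>
        (\<exists>g\<in>G - {\<one>\<^bsub>BijGroup unit_circle\<^esub>}. emeasure \<mu> (A \<inter> g ` A) > 0))"

end

theory Submission
  imports Defs
begin

text \<open>If the measure is not conservative, a wandering set of positive measure has disjoint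
  translates, so some point \<open>x\<close> of the minimal set satisfies \<open>\<Sum>\<^sub>g g'(x)\<^sup>\<delta> < \<infinity>\<close>. By minimality the orbit
  of \<open>x\<close> accumulates at \<open>x\<close>.

  For \<open>\<delta> > 0\<close> also \<open>\<Sum>\<^sub>g g'(x) < \<infinity>\<close>. Schwartz' estimate along geodesic words then bounds the distortion
  of all elements of the group on one neighbourhood of \<open>x\<close>. An element with small derivative that
  moves \<open>x\<close> only slightly contracts this neighbourhood into itself; at its fixed point the
  derivatives of its inverse powers are unbounded, against the distortion bound.

  For \<open>\<delta> = 0\<close> the group would be finite. For \<open>\<delta> < 0\<close> the derivatives at \<open>x\<close> tend to infinity along
  the group. Denjoy's argument for a closest return excludes this for the powers of an element of
  infinite order, so the group is a torsion group. Elements of finite order have no fixed points,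
  hence by Hoelder's theorem the group is abelian; being finitely generated, it is finite.\<close>

subsection \<open>Lifts of circle maps\<close>

text \<open>The hypothesis \<delta> \<le> 1 enters in the passage from \<Sum> g'(x)^\<delta> to
  \<Sum> g'(x): all but finitely many terms are below 1, and there y \<le> y^\<delta> for 0 <
  \<delta> \<le> 1. The sum runs over the whole group, which is what lets distortion be controlled
  along every geodesic word from a single point x. What replaces it: at a closest return
  \<open>f^q\<close> of x, the derivatives of \<open>f^q\<close> and \<open>f^(-q)\<close> at x have
  bounded product, although both tend to infinity with |q|. Hence closest returns from one side
  stop, which leaves an arc at x that no power of f returns to. Its images are disjoint, but bounded
  distortion and the derivatives at x keep their lengths away from 0. Lengths and order are needed
  throughout, so everything is carried out for lifts to the line, where a lift is determined up to
  translation by a multiple of 2 pi.\<close>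

lemma cis_eq_cis_iff: "cis a = cis b \<longleftrightarrow> (\<exists>n::int. a = b + 2 * pi * n)"
  unfolding complex_eq_iff using sin_cos_eq_iff[of a b] by auto

text \<open>Rotating by \<open>cis (- b)\<close> moves the comparison to the point 1, where
  \<open>Arg\<close> is continuous; since rotations are isometries, one \<eta> serves all
  \<open>a\<close> and \<open>b\<close>.\<close>

lemma cis_near_imp_near:
  assumes "\<epsilon> > 0"
  shows "\<exists>\<eta>>0. \<forall>a b. dist (cis a) (cis b) < \<eta> \<longrightarrow> (\<exists>n::int. \<bar>a + 2 * pi * n - b\<bar> < \<epsilon>)"
proof -
  have "continuous (at 1) Arg"
    by (rule continuous_at_Arg) (auto simp: complex_nonpos_Reals_iff)
  then obtain \<eta> where \<eta>: "\<eta> > 0" "\<And>z. dist z 1 < \<eta> \<Longrightarrow> dist (Arg z) (Arg 1) < \<epsilon>"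
    using assms unfolding continuous_at_eps_delta by blast
  have "\<exists>n::int. \<bar>a + 2 * pi * n - b\<bar> < \<epsilon>" if d: "dist (cis a) (cis b) < \<eta>" for a b
  proof -
    have "dist (cis (a - b)) 1 = norm (cis b * (cis (a - b) - 1))"
      by (simp add: norm_mult dist_norm)
    also have "cis b * (cis (a - b) - 1) = cis a - cis b"
      by (simp add: algebra_simps cis_mult)
    finally have "dist (cis (a - b)) 1 < \<eta>" using d by (simp add: dist_norm)
    then have A: "\<bar>Arg (cis (a - b))\<bar> < \<epsilon>" using \<eta>(2) by fastforce
    have "cis (Arg (cis (a - b))) = cis (a - b)" by (simp add: cis_Arg sgn_eq)
    then obtain n :: int where "Arg (cis (a - b)) = a - b + 2 * pi * n"
      unfolding cis_eq_cis_iff by blast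
    then show ?thesis using A by (intro exI[of _ n]) (simp add: algebra_simps)
  qed
  then show ?thesis using \<eta>(1) by blast
qed

lemma unit_circle_cis: "z \<in> unit_circle \<longleftrightarrow> (\<exists>t. z = cis t)"
proof
  assume "z \<in> unit_circle"
  then have "norm z = 1" "z \<noteq> 0" by auto
  then have "z = cis (Arg z)" by (simp add: cis_Arg sgn_eq)
  then show "\<exists>t. z = cis t" by blast
qed auto

text \<open>Differentiability is demanded instead of continuity: the derivative of a lift is then
  forced to be the angular derivative, and uniqueness up to translation becomes a statement about
  functions with derivative 0.\<close>

definition lift :: "(complex \<Rightarrow> complex) \<Rightarrow> (real \<Rightarrow> real) \<Rightarrow> bool" where
  "lift g F \<longleftrightarrow> (\<forall>t. g (cis t) = cis (F t)) \<and> (\<forall>t. F differentiable (at t))"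

lemma lift_cis: "lift g F \<Longrightarrow> g (cis t) = cis (F t)"
  by (simp add: lift_def)

lemma angular_deriv_cis:
  assumes "((\<lambda>t. g (cis t)) has_vector_derivative u') (at t)"
  shows "angular_deriv g (cis t) = Re (u' / (\<i> * g (cis t)))"
proof -
  have "((\<lambda>s. t + s) has_vector_derivative 1) (at 0)"
    by (auto intro!: derivative_eq_intros)
  then have "(((\<lambda>t. g (cis t)) \<circ> (\<lambda>s. t + s)) has_vector_derivative (1 *\<^sub>R u')) (at 0)"
    using assms by (intro vector_diff_chain_at) auto
  then have "((\<lambda>s. g (cis t * cis s)) has_vector_derivative u') (at 0)"
    by (simp add: o_def cis_mult)
  then show ?thesis unfolding angular_deriv_def by (simp add: vector_derivative_at)
qed

lemma lift_has_derivative: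
  assumes "lift g F"
  shows "(F has_real_derivative angular_deriv g (cis t)) (at t)"
proof -
  from assms obtain D where D: "(F has_real_derivative D) (at t)"
    unfolding lift_def using real_differentiable_def by blast
  then have "((\<lambda>s. cis (F s)) has_vector_derivative (D *\<^sub>R (\<i> * cis (F t)))) (at t)"
    unfolding has_vector_derivative_def has_field_derivative_def
    by (auto intro!: derivative_eq_intros ext simp: algebra_simps)
  then have "((\<lambda>s. g (cis s)) has_vector_derivative (D *\<^sub>R (\<i> * cis (F t)))) (at t)"
    using assms by (simp add: lift_cis)
  from angular_deriv_cis[OF this] have "angular_deriv g (cis t) = D"
    using assms by (simp add: lift_cis scaleR_conv_of_real)
  with D show ?thesis by simp
qed

lemma lift_shift: "lift g F \<Longrightarrow> lift g (\<lambda>t. F t + 2 * pi * of_int n)"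
proof -
  assume F: "lift g F"
  have "cis (F t + 2 * pi * of_int n) = cis (F t)" for t
    unfolding cis_eq_cis_iff by blast
  then show ?thesis using F unfolding lift_def by (auto intro!: derivative_intros)
qed

lemma lift_unique:
  assumes "lift g F" "lift g H"
  shows "\<exists>n::int. H = (\<lambda>t. F t + 2 * pi * n)"
proof -
  have "((\<lambda>t. H t - F t) has_real_derivative 0) (at t)" for t
    using DERIV_diff[OF lift_has_derivative[OF assms(2)] lift_has_derivative[OF assms(1)]] by simp
  then have const: "H t - F t = H 0 - F 0" for t
    using DERIV_isconst_all[of "\<lambda>t. H t - F t"] by blast
  have "cis (H 0) = cis (F 0)" using assms by (metis lift_cis)
  then obtain n :: int where "H 0 = F 0 + 2 * pi * n" unfolding cis_eq_cis_iff by blast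
  then have "H t = F t + 2 * pi * n" for t using const[of t] by simp
  then show ?thesis by blast
qed

lemma lift_compose:
  assumes "lift g F" "lift h H"
  shows "lift (compose unit_circle g h) (\<lambda>t. F (H t))"
  unfolding lift_def
proof (intro conjI allI)
  fix t
  show "compose unit_circle g h (cis t) = cis (F (H t))"
    using assms by (simp add: compose_def lift_cis)
  show "(\<lambda>t. F (H t)) differentiable at t"
    using DERIV_chain2[OF lift_has_derivative[OF assms(1)] lift_has_derivative[OF assms(2)]]
    unfolding real_differentiable_def by blast
qed

lemma angular_deriv_compose:
  assumes "lift g F" "lift h H"
  shows "angular_deriv (compose unit_circle g h) (cis t)
    = angular_deriv g (h (cis t)) * angular_deriv h (cis t)"
proof -
  have "((\<lambda>t. F (H t)) has_real_derivative (angular_deriv g (cis (H t)) * angular_deriv h (cis t))) (at t)"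
    by (rule DERIV_chain2[OF lift_has_derivative[OF assms(1)] lift_has_derivative[OF assms(2)]])
  then have "angular_deriv g (cis (H t)) * angular_deriv h (cis t)
      = angular_deriv (compose unit_circle g h) (cis t)"
    using lift_has_derivative[OF lift_compose[OF assms]] by (rule DERIV_unique)
  then show ?thesis using assms(2) by (simp add: lift_cis)
qed

lemma lift_id: "lift (\<lambda>z\<in>unit_circle. z) (\<lambda>t. t)"
  by (auto simp: lift_def)

text \<open>The lift is a constant plus an antiderivative of the angular derivative
  \<open>a\<close>. As \<open>u\<close> has constant norm 1, \<open>u'\<close> is orthogonal to
  \<open>u\<close>, hence equal to \<open>a\<close> times \<open>\<i> * u\<close>; then
  \<open>u\<close> times \<open>cis (- F0)\<close> has derivative 0.\<close>

lemma
  assumes "circle_C_k 1 g" "g \<in> unit_circle \<rightarrow> unit_circle"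
  shows lift_exists: "\<exists>F. lift g F"
    and continuous_angular_deriv_cis: "continuous_on UNIV (\<lambda>t. angular_deriv g (cis t))"
proof -
  define u where "u t = g (cis t)" for t
  from assms(1) obtain u' where u': "\<And>t. (u has_vector_derivative u' t) (at t)"
    and cu': "continuous_on UNIV u'"
    unfolding circle_C_k_def One_nat_def C_k.simps u_def[abs_def] by blast
  have nu: "norm (u t) = 1" for t using assms(2) by (auto simp: u_def)
  then have u0: "u t \<noteq> 0" for t by (metis norm_zero zero_neq_one)
  have cu: "continuous_on UNIV u"
    using u' by (meson continuous_at_imp_continuous_on has_vector_derivative_continuous)
  define a where "a t = angular_deriv g (cis t)" for t
  have a: "a t = Re (u' t / (\<i> * u t))" for t
    unfolding a_def u_def by (rule angular_deriv_cis) (use u' in \<open>simp add: u_def[abs_def]\<close>)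
  show ca: "continuous_on UNIV (\<lambda>t. angular_deriv g (cis t))"
    unfolding a_def[symmetric] a by (intro continuous_intros cu' cu) (simp add: u0)
  have u'_eq: "u' t = a t *\<^sub>R (\<i> * u t)" for t
  proof -
    have "((\<lambda>t. u t \<bullet> u t) has_derivative (\<lambda>h. u t \<bullet> (h *\<^sub>R u' t) + (h *\<^sub>R u' t) \<bullet> u t)) (at t)"
      using u'[of t] unfolding has_vector_derivative_def by (auto intro!: derivative_eq_intros)
    moreover have "(\<lambda>t. u t \<bullet> u t) = (\<lambda>t. 1)"
      using nu by (simp add: dot_square_norm)
    ultimately have "((\<lambda>t. 1::real) has_derivative (\<lambda>h. u t \<bullet> (h *\<^sub>R u' t) + (h *\<^sub>R u' t) \<bullet> u t)) (at t)"
      by simp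
    moreover have "((\<lambda>t. 1::real) has_derivative (\<lambda>h. 0)) (at t)" by simp
    ultimately have "(\<lambda>h. u t \<bullet> (h *\<^sub>R u' t) + (h *\<^sub>R u' t) \<bullet> u t) = (\<lambda>h. 0)"
      by (rule has_derivative_unique)
    from fun_cong[OF this, of 1] have orth: "u t \<bullet> u' t = 0" by (simp add: inner_commute)
    have "Im (u' t / (\<i> * u t)) = 0"
    proof -
      have "u' t / (\<i> * u t) = u' t * cnj (\<i> * u t)"
        by (simp add: complex_div_cnj[of "u' t"] norm_mult nu)
      then have "Im (u' t / (\<i> * u t)) = - (u t \<bullet> u' t)" by (simp add: inner_complex_def)
      then show ?thesis using orth by simp
    qed
    then have "u' t / (\<i> * u t) = of_real (a t)" by (simp add: a complex_eq_iff)
    then show ?thesis using u0[of t] by (simp add: field_simps scaleR_conv_of_real)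
  qed
  obtain F0 where F0: "\<And>t. (F0 has_vector_derivative a t) (at t)"
    using einterval_antiderivative[of "-\<infinity>" "\<infinity>" a] ca
    by (auto simp: a_def[abs_def] continuous_on_eq_continuous_at)
  have "((\<lambda>t. u t * cis (- F0 t)) has_derivative (\<lambda>h. 0)) (at t)" for t
    using u'[of t] F0[of t] unfolding has_vector_derivative_def
    by (auto intro!: derivative_eq_intros ext simp: u'_eq algebra_simps)
  then obtain c where c: "\<And>t. u t * cis (- F0 t) = c"
    using has_derivative_zero_constant[of UNIV "\<lambda>t. u t * cis (- F0 t)"] by auto
  then have "norm c = 1" using nu by (metis mult_cancel_right1 norm_cis norm_mult)
  then obtain \<theta> where \<theta>: "c = cis \<theta>" using unit_circle_cis[of c] by auto
  have "u t = cis (\<theta> + F0 t)" for t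
  proof -
    have "u t = (u t * cis (- F0 t)) * cis (F0 t)" by (simp add: cis_mult mult.assoc)
    then show ?thesis by (simp add: c \<theta> cis_mult)
  qed
  moreover have "(\<lambda>t. \<theta> + F0 t) differentiable (at t)" for t
    using F0[of t] unfolding has_vector_derivative_def
    by (intro derivative_intros) (auto simp: differentiable_def)
  ultimately have "lift g (\<lambda>t. \<theta> + F0 t)" by (simp add: lift_def u_def)
  then show "\<exists>F. lift g F" by blast
qed

lemma Re_div_unit: "norm w = 1 \<Longrightarrow> Re (z / w) = w \<bullet> z"
  by (simp add: complex_div_cnj[of z] inner_complex_def)

lemma shift_to_period: "\<exists>n::int. t + 2 * pi * n \<in> {0..2*pi}"
proof -
  have "t - 2 * pi * \<lfloor>t / (2*pi)\<rfloor> = 2 * pi * frac (t / (2*pi))"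
    by (simp add: frac_def field_simps)
  moreover have "frac (t / (2*pi)) \<le> 1" by (rule less_imp_le, rule frac_lt_1)
  ultimately have "t + 2 * pi * of_int (- \<lfloor>t / (2*pi)\<rfloor>) \<in> {0..2*pi}"
    by (auto simp: mult_le_cancel_left1)
  then show ?thesis by blast
qed

lemma cis_shift [simp]: "cis (t + 2 * pi * of_int n) = cis t"
  unfolding cis_eq_cis_iff by blast

text \<open>This is where two derivatives are used: the angular derivative \<open>a\<close> is C1
  and positive, so \<open>a' / a\<close> is continuous, and periodicity reduces its boundedness to a
  compact interval.\<close>

lemma ln_angular_deriv_Lipschitz:
  assumes g: "orientation_preserving_C2_diffeo g"
  shows "\<exists>D\<ge>0. \<forall>a b. \<bar>ln (angular_deriv g (cis a)) - ln (angular_deriv g (cis b))\<bar> \<le> D * \<bar>a - b\<bar>"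
proof -
  define u where "u t = g (cis t)" for t
  define a where "a t = angular_deriv g (cis t)" for t
  from g have "C_k 2 u"
    unfolding orientation_preserving_C2_diffeo_def circle_C_k_def u_def[abs_def] by blast
  then obtain u' u'' where u': "\<And>t. (u has_vector_derivative u' t) (at t)"
    and u'': "\<And>t. (u' has_vector_derivative u'' t) (at t)" and cu'': "continuous_on UNIV u''"
    unfolding numeral_2_eq_2 C_k.simps by blast
  have pos: "a t > 0" for t
    using g unfolding orientation_preserving_C2_diffeo_def a_def by auto
  have "g \<in> unit_circle \<rightarrow> unit_circle"
    using g unfolding orientation_preserving_C2_diffeo_def by (simp add: bij_betw_imp_funcset)
  then have nu: "norm (u t) = 1" for t by (auto simp: u_def)
  have a: "a t = (\<i> * u t) \<bullet> u' t" for t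
    unfolding a_def angular_deriv_cis[of g, OF u'[unfolded u_def[abs_def]]] u_def[symmetric]
    by (rule Re_div_unit) (simp add: norm_mult nu)
  \<comment> \<open>The product rule also yields the inner product of \<open>\<i> * u'\<close> with
    \<open>u'\<close>, which vanishes because multiplication by \<open>\<i>\<close> is a quarter
    turn.\<close>
  define a' where "a' t = (\<i> * u t) \<bullet> u'' t" for t
  have da: "(a has_real_derivative a' t) (at t)" for t
  proof -
    have "(a has_derivative (\<lambda>h. (\<i> * u t) \<bullet> (h *\<^sub>R u'' t) + (\<i> * (h *\<^sub>R u' t)) \<bullet> u' t)) (at t)"
      unfolding a[abs_def] using u'[of t] u''[of t] unfolding has_vector_derivative_def
      by (auto intro!: derivative_eq_intros)
    moreover have "(\<lambda>h. (\<i> * u t) \<bullet> (h *\<^sub>R u'' t) + (\<i> * (h *\<^sub>R u' t)) \<bullet> u' t) = (*) (a' t)"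
      by (rule ext) (simp add: a'_def inner_complex_def algebra_simps)
    ultimately show ?thesis by (simp add: has_field_derivative_def)
  qed
  have cu: "continuous_on UNIV u"
    using u' by (meson continuous_at_imp_continuous_on has_vector_derivative_continuous)
  have ca: "continuous_on UNIV a"
    using da by (meson DERIV_isCont continuous_at_imp_continuous_on)
  have ca': "continuous_on UNIV a'"
    unfolding a'_def[abs_def] by (intro continuous_intros cu cu'')
  have dL: "((\<lambda>t. ln (a t)) has_real_derivative (a' t / a t)) (at t)" for t
    using da[of t] pos[of t] by (auto intro!: derivative_eq_intros)
  have "continuous_on {0..2*pi} (\<lambda>t. a' t / a t)"
    using pos by (intro continuous_intros continuous_on_subset[OF ca] continuous_on_subset[OF ca'])
      (auto simp: less_imp_neq[symmetric] order_less_imp_not_eq2)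
  then have "bounded ((\<lambda>t. a' t / a t) ` {0..2*pi})"
    by (intro compact_imp_bounded compact_continuous_image) auto
  then obtain D where D: "\<And>t. t \<in> {0..2*pi} \<Longrightarrow> \<bar>a' t / a t\<bar> \<le> D"
    unfolding bounded_iff ball_simps real_norm_def by blast
  have D': "\<bar>a' t / a t\<bar> \<le> D" for t
  proof -
    obtain n :: int where n: "t + 2 * pi * n \<in> {0..2*pi}" using shift_to_period by blast
    have "((\<lambda>s. ln (a (s + 2 * pi * n))) has_real_derivative
        (a' (t + 2 * pi * n) / a (t + 2 * pi * n))) (at t)"
      using dL[of "t + 2 * pi * n"] by (simp only: DERIV_shift)
    then have "((\<lambda>s. ln (a s)) has_real_derivative
        (a' (t + 2 * pi * n) / a (t + 2 * pi * n))) (at t)"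
      by (simp add: a_def)
    then have "a' t / a t = a' (t + 2 * pi * n) / a (t + 2 * pi * n)"
      using dL DERIV_unique by blast
    with D[OF n] show ?thesis by simp
  qed
  have "\<bar>ln (a s) - ln (a t)\<bar> \<le> D * \<bar>s - t\<bar>" for s t
    using field_differentiable_bound[of UNIV "\<lambda>t. ln (a t)" "\<lambda>t. a' t / a t" D s t] dL D'
    by auto
  moreover have "D \<ge> 0" using D'[of 0] by linarith
  ultimately show ?thesis unfolding a_def by blast
qed

lemma lift_strict_mono:
  assumes "lift g F" "\<And>z. z \<in> unit_circle \<Longrightarrow> angular_deriv g z > 0"
  shows "strict_mono F"
proof (rule strict_monoI)
  fix s t :: real assume "s < t"
  then show "F s < F t"
    using lift_has_derivative[OF assms(1)] assms(2)
    by (intro DERIV_pos_imp_increasing[of s t F]) (auto intro!: exI)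
qed

lemma lift_isCont: "lift g F \<Longrightarrow> isCont F t"
  using lift_has_derivative DERIV_isCont by blast

text \<open>The map has degree one. Monotonicity makes the degree positive; were it at least 2, the
  lift would reach \<open>F 0 + 2 * pi\<close> strictly inside a period, against injectivity on the
  circle.\<close>

lemma lift_add_period:
  assumes F: "lift g F" and inj: "inj_on g unit_circle"
    and pos: "\<And>z. z \<in> unit_circle \<Longrightarrow> angular_deriv g z > 0"
  shows "F (t + 2 * pi * of_int m) = F t + 2 * pi * of_int m"
proof -
  have sm: "strict_mono F" by (rule lift_strict_mono[OF F pos])
  have 1: "F (t + 2 * pi) = F t + 2 * pi" for t
  proof -
    have "lift g (\<lambda>t. F (t + 2 * pi))"
      unfolding lift_def
    proof (intro conjI allI)
      fix t show "g (cis t) = cis (F (t + 2 * pi))"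
        using lift_cis[OF F, of "t + 2 * pi"] cis_shift[of t 1] by simp
      show "(\<lambda>t. F (t + 2 * pi)) differentiable at t"
        using lift_has_derivative[OF F, of "t + 2*pi"] unfolding real_differentiable_def DERIV_shift
        by blast
    qed
    from lift_unique[OF F this] obtain n :: int where n: "\<And>t. F (t + 2 * pi) = F t + 2 * pi * n"
      unfolding fun_eq_iff by blast
    have "F 0 < F (0 + 2 * pi)" using strict_monoD[OF sm, of 0 "0 + 2 * pi"] by simp
    then have "n > 0" using n[of 0] by (simp add: zero_less_mult_iff)
    have "n = 1"
    proof (rule ccontr)
      assume "n \<noteq> 1"
      with \<open>n > 0\<close> have "real_of_int n \<ge> 2" by linarith
      then have "2 * pi * n \<ge> 2 * pi * 2" by (intro mult_left_mono) auto
      with n[of 0] have ge: "F (2 * pi) \<ge> F 0 + 4 * pi" by simp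
      have "\<exists>t\<ge>0. t \<le> 2*pi \<and> F t = F 0 + 2 * pi"
      proof (rule IVT)
        show "F 0 + 2 * pi \<le> F (2 * pi)" using ge pi_gt_zero by linarith
      qed (use lift_isCont[OF F] in simp_all)
      then obtain t where t: "0 \<le> t" "t \<le> 2 * pi" "F t = F 0 + 2 * pi" by blast
      have "t \<noteq> 0" "t \<noteq> 2 * pi" using t ge pi_gt_zero by auto
      have "g (cis t) = g (cis 0)"
        using t(3) cis_shift[of "F 0" 1] by (simp only: lift_cis[OF F]) simp
      then have "cis t = cis 0" using inj by (simp add: inj_on_def)
      then obtain k :: int where k: "t = 2 * pi * k" unfolding cis_eq_cis_iff by auto
      have "0 < t" "t < 2 * pi" using t \<open>t \<noteq> 0\<close> \<open>t \<noteq> 2 * pi\<close> by linarith+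
      then have "0 < k" "k < 1"
        unfolding k by (simp_all add: zero_less_mult_iff)
      then show False by linarith
    qed
    with n show ?thesis by simp
  qed
  have nat: "F (t + 2 * pi * real k) = F t + 2 * pi * real k" for t k
  proof (induction k)
    case (Suc k)
    have "F (t + 2 * pi * real (Suc k)) = F ((t + 2 * pi * real k) + 2 * pi)"
      by (simp add: algebra_simps)
    also have "\<dots> = F t + 2 * pi * real k + 2 * pi" by (simp only: 1 Suc)
    finally show ?case by (simp add: algebra_simps)
  qed simp
  show ?thesis
  proof (cases "m \<ge> 0")
    case True
    then show ?thesis using nat[of t "nat m"] by simp
  next
    case False
    then show ?thesis using nat[of "t + 2 * pi * m" "nat (- m)"] by simp
  qed
qed

text \<open>Preimages of closed sets are images under \<open>cis\<close> of compact subsets of one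
  period, hence closed.\<close>

lemma continuous_on_circleI:
  fixes h :: "complex \<Rightarrow> 'a::topological_space"
  assumes "continuous_on UNIV (\<lambda>t. h (cis t))"
  shows "continuous_on unit_circle h"
  unfolding continuous_on_closed_vimage[OF closed_sphere]
proof (intro allI impI)
  fix B :: "'a set" assume B: "closed B"
  have "h -` B \<inter> unit_circle = cis ` ({0..2*pi} \<inter> (\<lambda>t. h (cis t)) -` B)" (is "?L = ?R")
  proof (intro equalityI subsetI)
    fix z assume z: "z \<in> ?L"
    then obtain t where t: "z = cis t" using unit_circle_cis by blast
    obtain n :: int where n: "t + 2 * pi * n \<in> {0..2*pi}" using shift_to_period by blast
    have "z = cis (t + 2 * pi * n)" using t by simp
    with n z show "z \<in> ?R" by blast
  qed auto
  moreover have "compact ({0..2*pi} \<inter> (\<lambda>t. h (cis t)) -` B)"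
    using continuous_closed_vimage[OF B] assms
    by (intro compact_Int_closed) (auto simp: continuous_on_eq_continuous_at)
  then have "compact ?R"
    by (intro compact_continuous_image continuous_intros)
  ultimately show "closed (h -` B \<inter> unit_circle)"
    by (simp add: compact_imp_closed)
qed

lemma (in group) inj_int_pow:
  assumes "x \<in> carrier G" "\<And>n::nat. n > 0 \<Longrightarrow> x [^] n \<noteq> \<one>"
  shows "inj (\<lambda>k::int. x [^] k)"
proof (rule injI)
  have *: "False" if "x [^] j = x [^] k" "j < k" for j k :: int
  proof -
    have "x [^] (k - j) = \<one>"
      unfolding int_pow_diff[OF assms(1)] that(1) using assms(1) by simp
    moreover have "int (nat (k - j)) = k - j" using that(2) by simp
    ultimately have "x [^] int (nat (k - j)) = \<one>" by (simp only:)
    then have "x [^] (nat (k - j)) = \<one>" unfolding int_pow_int .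
    then show False using assms(2)[of "nat (k - j)"] that(2) by simp
  qed
  fix j k :: int assume eq: "x [^] j = x [^] k"
  show "j = k"
  proof (cases j k rule: linorder_cases)
    case less
    from *[OF eq this] show ?thesis ..
  next
    case greater
    from *[OF eq[symmetric] this] show ?thesis ..
  qed
qed

subsection \<open>Groups of circle diffeomorphisms\<close>

text \<open>The generating set is a parameter because word length depends on it.\<close>

locale circle_group =
  fixes G S :: "(complex \<Rightarrow> complex) set"
  assumes C2: "C2_diffeo_group G"
    and fin_S: "finite S" and S_subset: "S \<subseteq> G"
    and gen_S: "generate (BijGroup unit_circle) S = G"
begin

abbreviation "M \<equiv> BijGroup unit_circle"

sublocale M: group M
  by (rule group_BijGroup)

sublocale subgroup G M
  using C2 by (simp add: C2_diffeo_group_def)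

lemma diffeo: "g \<in> G \<Longrightarrow> orientation_preserving_C2_diffeo g"
  using C2 by (simp add: C2_diffeo_group_def)

lemma in_Bij: "g \<in> G \<Longrightarrow> g \<in> Bij unit_circle"
  using subset by (auto simp: BijGroup_def)

lemma bij: "g \<in> G \<Longrightarrow> bij_betw g unit_circle unit_circle"
  using diffeo orientation_preserving_C2_diffeo_def by blast

lemma inj: "g \<in> G \<Longrightarrow> inj_on g unit_circle"
  using bij bij_betw_def by blast

lemma maps: "g \<in> G \<Longrightarrow> g \<in> unit_circle \<rightarrow> unit_circle"
  using bij bij_betw_imp_funcset by blast

lemma ad_pos: "g \<in> G \<Longrightarrow> z \<in> unit_circle \<Longrightarrow> angular_deriv g z > 0"
  using diffeo orientation_preserving_C2_diffeo_def by blast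

lemma ad_cis_pos [simp]: "g \<in> G \<Longrightarrow> angular_deriv g (cis t) > 0"
  by (rule ad_pos) auto

lemma mult_eq: "g \<in> G \<Longrightarrow> h \<in> G \<Longrightarrow> g \<otimes>\<^bsub>M\<^esub> h = compose unit_circle g h"
  using in_Bij by (simp add: BijGroup_def)

lemma one_eq: "\<one>\<^bsub>M\<^esub> = (\<lambda>z\<in>unit_circle. z)"
  by (simp add: BijGroup_def)

lemma mult_apply: "g \<in> G \<Longrightarrow> h \<in> G \<Longrightarrow> z \<in> unit_circle \<Longrightarrow> (g \<otimes>\<^bsub>M\<^esub> h) z = g (h z)"
  by (simp add: mult_eq compose_def)

lemma inv_apply: "g \<in> G \<Longrightarrow> z \<in> unit_circle \<Longrightarrow> (inv\<^bsub>M\<^esub> g) (g z) = z"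
  using mult_apply[of "inv\<^bsub>M\<^esub> g" g z] M.l_inv[of g] subset by (auto simp: one_eq)

lemma apply_inv: "g \<in> G \<Longrightarrow> z \<in> unit_circle \<Longrightarrow> g ((inv\<^bsub>M\<^esub> g) z) = z"
  using mult_apply[of g "inv\<^bsub>M\<^esub> g" z] M.r_inv[of g] subset by (auto simp: one_eq)

lemma C1: assumes "g \<in> G" shows "circle_C_k 1 g"
proof -
  from diffeo[OF assms] have "circle_C_k 2 g"
    unfolding orientation_preserving_C2_diffeo_def by blast
  then obtain h h' where "\<And>t. ((\<lambda>t. g (cis t)) has_vector_derivative h t) (at t)"
    "\<And>t. (h has_vector_derivative h' t) (at t)"
    unfolding circle_C_k_def numeral_2_eq_2 C_k.simps by blast
  then show ?thesis unfolding circle_C_k_def One_nat_def C_k.simps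
    by (meson continuous_at_imp_continuous_on has_vector_derivative_continuous)
qed

lemma lift_ex: "g \<in> G \<Longrightarrow> \<exists>F. lift g F"
  using lift_exists[OF C1 maps] .

lemma lift_mult: "g \<in> G \<Longrightarrow> h \<in> G \<Longrightarrow> lift g F \<Longrightarrow> lift h H \<Longrightarrow> lift (g \<otimes>\<^bsub>M\<^esub> h) (\<lambda>t. F (H t))"
  by (simp add: mult_eq lift_compose)

lemma lift_one: "lift \<one>\<^bsub>M\<^esub> (\<lambda>t. t)"
  by (simp add: one_eq lift_id)

lemma ad_one: "angular_deriv \<one>\<^bsub>M\<^esub> (cis t) = 1"
  using lift_has_derivative[OF lift_one, of t] DERIV_ident DERIV_unique by blast

lemma ad_mult: "g \<in> G \<Longrightarrow> h \<in> G \<Longrightarrow>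
    angular_deriv (g \<otimes>\<^bsub>M\<^esub> h) (cis t) = angular_deriv g (h (cis t)) * angular_deriv h (cis t)"
  using lift_ex[of g] lift_ex[of h] angular_deriv_compose mult_eq by metis

lemma lift_mono: "g \<in> G \<Longrightarrow> lift g F \<Longrightarrow> F s < F t \<longleftrightarrow> s < t"
  using lift_strict_mono[of g F] ad_pos strict_mono_less by blast

lemma lift_period: "g \<in> G \<Longrightarrow> lift g F \<Longrightarrow> F (t + 2 * pi * of_int m) = F t + 2 * pi * of_int m"
  using lift_add_period[OF _ inj ad_pos] by blast

text \<open>Any lift of the inverse, composed with \<open>F\<close>, is a lift of the identity, that
  is, a translation. Correcting by this translation gives an exact left inverse, and evaluating at
  \<open>F 0\<close> shows that it is also a right inverse.\<close>

lemma lift_inv: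
  assumes g: "g \<in> G" and F: "lift g F"
  shows "\<exists>H. lift (inv\<^bsub>M\<^esub> g) H \<and> (\<forall>t. H (F t) = t) \<and> (\<forall>t. F (H t) = t)"
proof -
  have ig: "inv\<^bsub>M\<^esub> g \<in> G" using g by simp
  obtain H0 where H0: "lift (inv\<^bsub>M\<^esub> g) H0" using lift_ex[OF ig] by blast
  have "inv\<^bsub>M\<^esub> g \<otimes>\<^bsub>M\<^esub> g = \<one>\<^bsub>M\<^esub>" using g subset by (intro M.l_inv) auto
  with lift_mult[OF ig g H0 F] have "lift \<one>\<^bsub>M\<^esub> (\<lambda>t. H0 (F t))" by simp
  from lift_unique[OF lift_one this] obtain n :: int where n: "\<And>t. H0 (F t) = t + 2 * pi * n"
    unfolding fun_eq_iff by blast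
  define H where "H t = H0 t + 2 * pi * of_int (- n)" for t
  have H: "lift (inv\<^bsub>M\<^esub> g) H" unfolding H_def[abs_def] by (rule lift_shift[OF H0])
  have HF: "H (F t) = t" for t by (simp add: H_def n)
  have "g \<otimes>\<^bsub>M\<^esub> inv\<^bsub>M\<^esub> g = \<one>\<^bsub>M\<^esub>" using g subset by (intro M.r_inv) auto
  with lift_mult[OF g ig F H] have "lift \<one>\<^bsub>M\<^esub> (\<lambda>t. F (H t))" by simp
  from lift_unique[OF lift_one this] obtain m :: int where m: "\<And>t. F (H t) = t + 2 * pi * m"
    unfolding fun_eq_iff by blast
  from m[of "F 0"] have "F 0 = F 0 + 2 * pi * m" by (simp only: HF)
  then have "m = 0" by simp
  then show ?thesis using H HF m by auto
qed

lemma nat_pow_mem: "g \<in> G \<Longrightarrow> g [^]\<^bsub>M\<^esub> (n::nat) \<in> G"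
  by (induction n) simp_all

lemma lift_nat_pow:
  assumes "g \<in> G" "lift g F"
  shows "lift (g [^]\<^bsub>M\<^esub> (n::nat)) (F ^^ n)"
proof (induction n)
  case 0
  then show ?case using lift_one by (simp add: id_def)
next
  case (Suc n)
  have "g [^]\<^bsub>M\<^esub> n \<in> G" using assms(1) by (rule nat_pow_mem)
  from lift_mult[OF this assms(1) Suc.IH assms(2)] show ?case
    by (simp add: funpow_Suc_right o_def del: funpow.simps)
qed

lemma int_pow_mem:
  assumes "g \<in> G"
  shows "g [^]\<^bsub>M\<^esub> (n::int) \<in> G"
proof (cases n rule: int_cases2)
  case (nonneg k)
  then show ?thesis using nat_pow_mem[OF assms, of k] by (simp only: int_pow_int)
next
  case (nonpos k)
  then show ?thesis
    using m_inv_closed[OF nat_pow_mem[OF assms, of k]] subset assms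
    by (simp only: M.int_pow_neg_int subset_iff)
qed

lemma mem_eqI:
  assumes "g \<in> G" "h \<in> G" "lift g F" "lift h F"
  shows "g = h"
proof -
  have "g \<in> extensional unit_circle" "h \<in> extensional unit_circle"
    using in_Bij assms Bij_imp_extensional by blast+
  then show ?thesis
  proof (rule extensionalityI)
    fix z assume "z \<in> unit_circle"
    then obtain t where "z = cis t" using unit_circle_cis by blast
    then show "g z = h z" using assms by (simp add: lift_cis)
  qed
qed

section \<open>Word length with respect to the generators\<close>

primrec words :: "nat \<Rightarrow> (complex \<Rightarrow> complex) set" where
  "words 0 = {\<one>\<^bsub>M\<^esub>}"
| "words (Suc n) = (\<lambda>(s, h). s \<otimes>\<^bsub>M\<^esub> h) ` ((S \<union> m_inv M ` S) \<times> words n)"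

lemma words_subset: "words n \<subseteq> G"
proof (induction n)
  case (Suc n)
  then show ?case using S_subset by auto
qed simp

lemma finite_words: "finite (words n)"
  by (induction n) (auto intro: fin_S)

lemma words_mult: "g \<in> words m \<Longrightarrow> h \<in> words n \<Longrightarrow> g \<otimes>\<^bsub>M\<^esub> h \<in> words (m + n)"
proof (induction m arbitrary: g)
  case 0
  then show ?case using words_subset[of n] subset by (auto simp: subset_iff)
next
  case (Suc m)
  then obtain s k where s: "s \<in> S \<union> m_inv M ` S" "k \<in> words m" "g = s \<otimes>\<^bsub>M\<^esub> k" by auto
  have "s \<in> G" using s(1) S_subset by auto
  then have "g \<otimes>\<^bsub>M\<^esub> h = s \<otimes>\<^bsub>M\<^esub> (k \<otimes>\<^bsub>M\<^esub> h)"
    unfolding s(3) using s(2) Suc.prems(2) words_subset[of m] words_subset[of n] subset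
    by (intro M.m_assoc) auto
  then show ?case using Suc.IH[OF s(2) Suc.prems(2)] s(1) by auto
qed

lemma generators_words:
  assumes "s \<in> S \<union> m_inv M ` S"
  shows "s \<in> words 1"
proof -
  have "s \<in> G" using assms S_subset by auto
  then have "s \<in> carrier M" using subset by (rule subsetD[rotated])
  then have "s = s \<otimes>\<^bsub>M\<^esub> \<one>\<^bsub>M\<^esub>" by simp
  with assms show ?thesis
    unfolding One_nat_def words.simps by (intro image_eqI[of _ _ "(s, \<one>\<^bsub>M\<^esub>)"]) simp_all
qed

lemma words_exhaust: "g \<in> G \<Longrightarrow> \<exists>n. g \<in> words n"
  unfolding gen_S[symmetric]
proof (induction rule: generate.induct)
  case one
  then show ?case using words.simps(1) by blast
next
  case (incl h)
  then show ?case using generators_words by blast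
next
  case (inv h)
  then show ?case using generators_words by blast
next
  case (eng g h)
  then show ?case using words_mult by blast
qed

lemma countable_G: "countable G"
proof -
  have "G = (\<Union>n. words n)"
    using words_exhaust words_subset by blast
  also have "countable (\<Union>n. words n)"
    by (simp add: countable_finite finite_words)
  finally show ?thesis .
qed

definition wlen :: "(complex \<Rightarrow> complex) \<Rightarrow> nat" where
  "wlen g = (LEAST n. g \<in> words n)"

lemma wlen_0: "g \<in> G \<Longrightarrow> wlen g = 0 \<Longrightarrow> g = \<one>\<^bsub>M\<^esub>"
  using LeastI_ex[OF words_exhaust, of g] by (simp add: wlen_def)

text \<open>Stripping the outermost letter of a shortest word leaves a shortest word, since a
  shorter spelling of \<open>h\<close> would shorten \<open>g\<close>.\<close>

lemma wlen_Suc: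
  assumes "g \<in> G" "wlen g = Suc n"
  shows "\<exists>s h. s \<in> S \<union> m_inv M ` S \<and> h \<in> G \<and> wlen h = n \<and> g = s \<otimes>\<^bsub>M\<^esub> h"
proof -
  have "g \<in> words (Suc n)"
    using LeastI_ex[OF words_exhaust[OF assms(1)]] unfolding wlen_def[symmetric] assms(2) .
  then obtain s h where s: "s \<in> S \<union> m_inv M ` S" "h \<in> words n" "g = s \<otimes>\<^bsub>M\<^esub> h" by auto
  have h: "h \<in> G" by (rule subsetD[OF words_subset s(2)])
  have "wlen h \<le> n"
    unfolding wlen_def using s(2) by (rule Least_le[of "\<lambda>n. h \<in> words n"])
  moreover have "h \<in> words (wlen h)"
    using LeastI_ex[OF words_exhaust[OF h]] unfolding wlen_def .
  then have "g \<in> words (Suc (wlen h))"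
    unfolding words.simps s(3) using s(1) by (intro image_eqI[of _ _ "(s, h)"]) simp_all
  then have "(LEAST n. g \<in> words n) \<le> Suc (wlen h)"
    by (rule Least_le[of "\<lambda>n. g \<in> words n"])
  then have "wlen g \<le> Suc (wlen h)" unfolding wlen_def[of g] .
  ultimately have "wlen h = n" using assms(2) by linarith
  with s(1,3) h show ?thesis by blast
qed

lemma Lipschitz_generators:
  "\<exists>D>0. \<forall>s\<in>S \<union> m_inv M ` S. \<forall>a b. \<bar>ln (angular_deriv s (cis a)) - ln (angular_deriv s (cis b))\<bar> \<le> D * \<bar>a - b\<bar>"
proof -
  let ?T = "S \<union> m_inv M ` S"
  have "\<forall>s\<in>?T. \<exists>D\<ge>0. \<forall>a b. \<bar>ln (angular_deriv s (cis a)) - ln (angular_deriv s (cis b))\<bar> \<le> D * \<bar>a - b\<bar>"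
  proof
    fix s assume "s \<in> ?T"
    then have "s \<in> G" using S_subset by auto
    then show "\<exists>D\<ge>0. \<forall>a b. \<bar>ln (angular_deriv s (cis a)) - ln (angular_deriv s (cis b))\<bar> \<le> D * \<bar>a - b\<bar>"
      by (rule ln_angular_deriv_Lipschitz[OF diffeo])
  qed
  then obtain D where D: "\<And>s. s \<in> ?T \<Longrightarrow> D s \<ge> 0"
    "\<And>s a b. s \<in> ?T \<Longrightarrow> \<bar>ln (angular_deriv s (cis a)) - ln (angular_deriv s (cis b))\<bar> \<le> D s * \<bar>a - b\<bar>"
    by metis
  have fT: "finite ?T" using fin_S by simp
  \<comment> \<open>The sum dominates each single constant; the summand 1 makes the result positive
    in all cases, so that it may serve as a denominator.\<close>
  show ?thesis
  proof (intro exI[of _ "1 + sum D ?T"] conjI ballI allI)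
    show "0 < 1 + sum D ?T" using sum_nonneg[of ?T D, OF D(1)] by linarith
    fix s a b assume s: "s \<in> ?T"
    have "D s \<le> sum D ?T"
      by (rule member_le_sum[OF s _ fT]) (rule D(1), blast)
    then have "D s * \<bar>a - b\<bar> \<le> (1 + sum D ?T) * \<bar>a - b\<bar>"
      by (intro mult_right_mono) auto
    with D(2)[OF s] show "\<bar>ln (angular_deriv s (cis a)) - ln (angular_deriv s (cis b))\<bar> \<le> (1 + sum D ?T) * \<bar>a - b\<bar>"
      by (meson order_trans)
  qed
qed


subsection \<open>Points with summable derivatives\<close>

lemma lift_diff_le:
  assumes "g \<in> G" "lift g F" "\<And>s. \<bar>s - t0\<bar> \<le> \<bar>t - t0\<bar> \<Longrightarrow> angular_deriv g (cis s) \<le> c"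
  shows "\<bar>F t - F t0\<bar> \<le> c * \<bar>t - t0\<bar>"
proof -
  have "norm (F t - F t0) \<le> c * norm (t - t0)"
  proof (rule field_differentiable_bound[of "cball t0 \<bar>t - t0\<bar>" F "\<lambda>s. angular_deriv g (cis s)" c])
    show "(F has_field_derivative angular_deriv g (cis s)) (at s within cball t0 \<bar>t - t0\<bar>)" for s
      using lift_has_derivative[OF assms(2)] by (rule has_field_derivative_at_within)
    fix s assume "s \<in> cball t0 \<bar>t - t0\<bar>"
    then have "\<bar>s - t0\<bar> \<le> \<bar>t - t0\<bar>" by (simp add: dist_real_def abs_minus_commute)
    with assms(3) show "norm (angular_deriv g (cis s)) \<le> c"
      using ad_cis_pos[OF assms(1), of s] by simp
  qed (auto simp: dist_real_def)
  then show ?thesis by simp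
qed

text \<open>Along a geodesic word the prefixes are distinct group elements, so the lengths of the
  successive images of a short interval are controlled by the sum of the derivatives at its
  midpoint.\<close>

lemma bounded_distortion:
  assumes sum: "\<And>H. finite H \<Longrightarrow> H \<subseteq> G \<Longrightarrow> (\<Sum>h\<in>H. angular_deriv h (cis t0)) \<le> T"
  shows "\<exists>r>0. \<forall>g\<in>G. \<forall>t. \<bar>t - t0\<bar> \<le> r \<longrightarrow> angular_deriv g (cis t) \<le> 2 * angular_deriv g (cis t0)"
proof -
  let ?a = "\<lambda>g t. angular_deriv g (cis t)"
  obtain D where D: "D > 0"
    "\<And>s a b. s \<in> S \<union> m_inv M ` S \<Longrightarrow> \<bar>ln (?a s a) - ln (?a s b)\<bar> \<le> D * \<bar>a - b\<bar>"
    using Lipschitz_generators by blast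
  have T: "T > 0" using sum[of "{\<one>\<^bsub>M\<^esub>}"] by (simp add: ad_one)
  \<comment> \<open>Chosen so that the total distortion \<open>2 * D * r * T\<close> is exactly
    \<open>ln 2\<close>. The factor 2 that this yields is the same factor that the induction
    assumes, so the estimate reproduces itself.\<close>
  define r where "r = ln 2 / (2 * D * T)"
  have r: "r > 0" unfolding r_def using D(1) T by simp
  have rT: "2 * D * r * T = ln 2" unfolding r_def using D(1) T by (simp add: field_simps)
  have concl: "?a g t \<le> 2 * ?a g t0"
    if g: "g \<in> G" and H: "finite H" "H \<subseteq> G"
      and le: "\<bar>ln (?a g t) - ln (?a g t0)\<bar> \<le> 2 * D * r * (\<Sum>h\<in>H. ?a h t0)" for g t H
  proof -
    have "2 * D * r * (\<Sum>h\<in>H. ?a h t0) \<le> 2 * D * r * T"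
      using sum[OF H] D(1) r by (intro mult_left_mono) auto
    with le rT have "ln (?a g t) \<le> ln 2 + ln (?a g t0)" by linarith
    also have "\<dots> = ln (2 * ?a g t0)" using ad_cis_pos[OF g, of t0] by (simp add: ln_mult)
    finally show ?thesis using ad_cis_pos[OF g, of t] ad_cis_pos[OF g, of t0] by simp
  qed
  \<comment> \<open>\<open>H\<close> collects the partial products of a geodesic word for
    \<open>g\<close>, without \<open>g\<close> itself. The bound on \<open>wlen\<close> guarantees
    that the element added in the induction step is new, so each derivative is counted once and the
    sum stays below \<open>T\<close>.\<close>
  have main: "\<exists>H. finite H \<and> H \<subseteq> G \<and> (\<forall>h\<in>H. wlen h < n) \<and>
      (\<forall>t. \<bar>t - t0\<bar> \<le> r \<longrightarrow> \<bar>ln (?a g t) - ln (?a g t0)\<bar> \<le> 2 * D * r * (\<Sum>h\<in>H. ?a h t0))"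
    if "g \<in> G" "wlen g = n" for g n
    using that
  proof (induction n arbitrary: g)
    case 0
    then have "g = \<one>\<^bsub>M\<^esub>" by (rule wlen_0)
    then show ?case by (intro exI[of _ "{}"]) (simp add: ad_one)
  next
    case (Suc n)
    obtain s h where s: "s \<in> S \<union> m_inv M ` S" and h: "h \<in> G" "wlen h = n"
      and g: "g = s \<otimes>\<^bsub>M\<^esub> h"
      using wlen_Suc[OF Suc.prems] by blast
    have sG: "s \<in> G" using s S_subset by auto
    obtain H where H: "finite H" "H \<subseteq> G" "\<forall>h\<in>H. wlen h < n"
      "\<And>t. \<bar>t - t0\<bar> \<le> r \<Longrightarrow> \<bar>ln (?a h t) - ln (?a h t0)\<bar> \<le> 2 * D * r * (\<Sum>h\<in>H. ?a h t0)"
      using Suc.IH[OF h] by blast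
    obtain F where F: "lift h F" using lift_ex[OF h(1)] by blast
    have hH: "h \<notin> H" using H(3) h(2) by auto
    have "\<bar>ln (?a g t) - ln (?a g t0)\<bar> \<le> 2 * D * r * (\<Sum>h\<in>insert h H. ?a h t0)"
      if t: "\<bar>t - t0\<bar> \<le> r" for t
    proof -
      \<comment> \<open>The factor 2 holds for \<open>h\<close> on the whole interval by induction,
        so the displacement of \<open>F t\<close> from \<open>F t0\<close> is at most
        \<open>2 * r\<close> times the derivative of \<open>h\<close> at \<open>t0\<close>; the next
        letter adds at most \<open>D\<close> times this displacement.\<close>
      have "\<bar>F t - F t0\<bar> \<le> (2 * ?a h t0) * \<bar>t - t0\<bar>"
      proof (rule lift_diff_le[OF h(1) F])
        fix s assume "\<bar>s - t0\<bar> \<le> \<bar>t - t0\<bar>"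
        with t have "\<bar>s - t0\<bar> \<le> r" by simp
        from H(4)[OF this] show "?a h s \<le> 2 * ?a h t0" by (rule concl[OF h(1) H(1,2)])
      qed
      also have "\<dots> \<le> (2 * ?a h t0) * r"
        using t ad_cis_pos[OF h(1), of t0] by (intro mult_left_mono) auto
      finally have "D * \<bar>F t - F t0\<bar> \<le> D * ((2 * ?a h t0) * r)"
        using D(1) by (intro mult_left_mono) auto
      then have 1: "\<bar>ln (?a s (F t)) - ln (?a s (F t0))\<bar> \<le> 2 * D * r * ?a h t0"
        using D(2)[OF s, of "F t" "F t0"] by (simp add: algebra_simps)
      have "ln (?a g u) = ln (?a s (F u)) + ln (?a h u)" for u
        unfolding g ad_mult[OF sG h(1)] lift_cis[OF F]
        using ad_cis_pos[OF sG, of "F u"] ad_cis_pos[OF h(1), of u] by (simp add: ln_mult)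
      then have "\<bar>ln (?a g t) - ln (?a g t0)\<bar>
          \<le> \<bar>ln (?a s (F t)) - ln (?a s (F t0))\<bar> + \<bar>ln (?a h t) - ln (?a h t0)\<bar>" by simp
      with 1 H(4)[OF t] show ?thesis
        unfolding sum.insert[OF H(1) hH] distrib_left by linarith
    qed
    then show ?case using H(1-3) h by (intro exI[of _ "insert h H"]) auto
  qed
  show ?thesis
  proof (intro exI[of _ r] conjI ballI allI impI)
    fix g t assume g: "g \<in> G" and t: "\<bar>t - t0\<bar> \<le> r"
    obtain H where H: "finite H" "H \<subseteq> G"
      "\<And>t. \<bar>t - t0\<bar> \<le> r \<Longrightarrow> \<bar>ln (?a g t) - ln (?a g t0)\<bar> \<le> 2 * D * r * (\<Sum>h\<in>H. ?a h t0)"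
      using main[OF g refl] by blast
    show "?a g t \<le> 2 * ?a g t0" by (rule concl[OF g H(1,2) H(3)[OF t]])
  qed (rule r)
qed

text \<open>A recurrent point whose derivatives are summable would lie near an attracting fixed point,
  where the derivatives of the inverse powers blow up.\<close>

lemma not_summable_recurrent:
  assumes sum: "\<And>H. finite H \<Longrightarrow> H \<subseteq> G \<Longrightarrow> (\<Sum>h\<in>H. angular_deriv h (cis t0)) \<le> T"
    and rec: "\<And>\<epsilon>. \<epsilon> > 0 \<Longrightarrow> infinite {g \<in> G. \<exists>F. lift g F \<and> \<bar>F t0 - t0\<bar> < \<epsilon>}"
  shows False
proof -
  let ?a = "\<lambda>g t. angular_deriv g (cis t)"
  obtain r where r: "r > 0" "\<And>g t. g \<in> G \<Longrightarrow> \<bar>t - t0\<bar> \<le> r \<Longrightarrow> ?a g t \<le> 2 * ?a g t0"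
    using bounded_distortion[of t0 T, OF sum] by blast
  \<comment> \<open>The constants fit together: a derivative below 1/8 at \<open>t0\<close> stays at
    most 1/4 on the interval of radius \<open>r\<close>, whose image lies within
    \<open>r / 4\<close> of \<open>F t0\<close> and hence within \<open>3 * r / 4\<close> of
    \<open>t0\<close>.\<close>
  define R where "R = {g \<in> G. \<exists>F. lift g F \<and> \<bar>F t0 - t0\<bar> < r / 2}"
  have "infinite R" unfolding R_def using r(1) by (intro rec) simp
  have "\<exists>g\<in>R. ?a g t0 < 1 / 8"
  proof (rule ccontr)
    assume c: "\<not> ?thesis"
    obtain H where H: "H \<subseteq> R" "finite H" "card H = nat \<lceil>8 * T\<rceil> + 1"
      using infinite_arbitrarily_large[OF \<open>infinite R\<close>] by metis
    have "real (card H) * (1 / 8) \<le> (\<Sum>h\<in>H. ?a h t0)"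
      using c H(1) by (intro sum_bounded_below) force
    also have "\<dots> \<le> T" using H by (intro sum) (auto simp: R_def)
    finally have "real (card H) \<le> 8 * T" by simp
    then show False unfolding H(3) by linarith
  qed
  then obtain g F where g: "g \<in> G" and F: "lift g F" "\<bar>F t0 - t0\<bar> < r / 2" and small: "?a g t0 < 1 / 8"
    unfolding R_def by blast
  have quarter: "?a g s \<le> 1 / 4" if "\<bar>s - t0\<bar> \<le> r" for s
    using r(2)[OF g that] small by simp
  have Fdiff: "\<bar>F t - F t0\<bar> \<le> r / 4" if t: "\<bar>t - t0\<bar> \<le> r" for t
  proof -
    have "\<bar>F t - F t0\<bar> \<le> 1 / 4 * \<bar>t - t0\<bar>"
      by (rule lift_diff_le[OF g F(1)]) (rule quarter, use t in linarith)
    also have "\<dots> \<le> 1 / 4 * r" using t by (rule mult_left_mono) simp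
    finally show ?thesis by simp
  qed
  have lo: "F (t0 - r) - (t0 - r) \<ge> 0" and hi: "F (t0 + r) - (t0 + r) \<le> 0"
  proof -
    have "\<bar>F (t0 - r) - F t0\<bar> \<le> r / 4" "\<bar>F (t0 + r) - F t0\<bar> \<le> r / 4"
      by (rule Fdiff, use r(1) in simp)+
    with F(2) r(1) show "F (t0 - r) - (t0 - r) \<ge> 0" "F (t0 + r) - (t0 + r) \<le> 0"
      by linarith+
  qed
  have "\<exists>p\<ge>t0 - r. p \<le> t0 + r \<and> F p - p = 0"
    using lo hi r(1) lift_isCont[OF F(1)] by (intro IVT2) (auto intro!: continuous_intros)
  then obtain p where "t0 - r \<le> p" "p \<le> t0 + r" "F p = p" by auto
  then have p: "\<bar>p - t0\<bar> \<le> r" "F p = p" by (simp_all add: abs_le_iff)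
  have gp: "g (cis p) = cis p" using lift_cis[OF F(1), of p] p(2) by simp
  let ?i = "inv\<^bsub>M\<^esub> g"
  have i: "?i \<in> G" using g by simp
  have ip: "?i (cis p) = cis p" using inv_apply[OF g, of "cis p"] gp by simp
  have "?i \<otimes>\<^bsub>M\<^esub> g = \<one>\<^bsub>M\<^esub>" using g subset by (intro M.l_inv) auto
  then have "?a ?i p * ?a g p = 1" using ad_mult[OF i g, of p] by (simp add: gp ad_one)
  then have "?a ?i p = 1 / ?a g p"
    using ad_cis_pos[OF g, of p] by (simp add: eq_divide_eq)
  then have four: "?a ?i p \<ge> 4"
    using quarter[OF p(1)] ad_cis_pos[OF g, of p] by (simp add: le_divide_eq)
  have pow: "?a (?i [^]\<^bsub>M\<^esub> n) p \<ge> 4 ^ n" for n :: nat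
  proof (induction n)
    case 0
    then show ?case by (simp add: ad_one)
  next
    case (Suc n)
    have "?a (?i [^]\<^bsub>M\<^esub> Suc n) p = ?a (?i [^]\<^bsub>M\<^esub> n) p * ?a ?i p"
      by (simp add: ad_mult[OF nat_pow_mem[OF i] i] ip)
    moreover have "4 ^ n * 4 \<le> ?a (?i [^]\<^bsub>M\<^esub> n) p * ?a ?i p" using Suc.IH four less_imp_le[OF ad_cis_pos[OF nat_pow_mem[OF i]]] by (intro mult_mono) auto
    ultimately show ?case by simp
  qed
  \<comment> \<open>At \<open>p\<close> the derivative of the inverse power is at least
    \<open>4 ^ n\<close>; the distortion bound and the sum over a single element limit it to
    \<open>2 * T\<close>.\<close>
  obtain n where n: "2 * T < 4 ^ n" using real_arch_pow[of 4 "2 * T"] by auto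
  let ?h = "?i [^]\<^bsub>M\<^esub> n"
  have h: "?h \<in> G" by (rule nat_pow_mem[OF i])
  have "?a ?h p \<le> 2 * ?a ?h t0" by (rule r(2)[OF h p(1)])
  moreover have "?a ?h t0 \<le> T" using sum[of "{?h}"] h by simp
  ultimately show False using pow[of n] n by linarith
qed

end

subsection \<open>Denjoy distortion for a single element\<close>

text \<open>Translating every left endpoint into one period keeps the open intervals disjoint. Since
  each has length at most 2 pi, they then lie in \<open>{0..4*pi}\<close>, which is the origin of
  the constant.\<close>

lemma sum_lengths_disjoint_mod_period:
  fixes a b :: "'i \<Rightarrow> real"
  assumes K: "finite K" and ab: "\<And>i. i \<in> K \<Longrightarrow> a i \<le> b i" "\<And>i. i \<in> K \<Longrightarrow> b i \<le> a i + 2 * pi"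
    and disj: "\<And>i j z m. i \<in> K \<Longrightarrow> j \<in> K \<Longrightarrow> i \<noteq> j \<Longrightarrow> a i < z \<Longrightarrow> z < b i \<Longrightarrow>
      a j + 2 * pi * of_int m < z \<Longrightarrow> z < b j + 2 * pi * of_int m \<Longrightarrow> False"
  shows "(\<Sum>i\<in>K. b i - a i) \<le> 4 * pi"
proof -
  have "\<forall>i. \<exists>n::int. a i + 2 * pi * n \<in> {0..2*pi}" using shift_to_period by blast
  then obtain n :: "'i \<Rightarrow> int" where n: "\<And>i. a i + 2 * pi * n i \<in> {0..2*pi}"
    unfolding choice_iff by blast
  define I where "I i = {a i + 2 * pi * n i<..<b i + 2 * pi * n i}" for i
  have meas: "measure lborel (I i) = b i - a i" if "i \<in> K" for i
    using ab(1)[OF that] by (simp add: I_def)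
  have "disjoint_family_on I K"
    unfolding disjoint_family_on_def
  proof (intro ballI impI equals0I)
    fix i j z assume ij: "i \<in> K" "j \<in> K" "i \<noteq> j" and z: "z \<in> I i \<inter> I j"
    show False
      by (rule disj[OF ij, of "z - 2 * pi * n i" "n j - n i"])
        (use z in \<open>auto simp: I_def algebra_simps\<close>)
  qed
  moreover have "I ` K \<subseteq> sets lborel" by (auto simp: I_def)
  moreover have "emeasure lborel (I i) \<noteq> \<infinity>" if "i \<in> K" for i using ab(1)[OF that] by (simp add: I_def)
  ultimately have "measure lborel (\<Union>i\<in>K. I i) = (\<Sum>i\<in>K. measure lborel (I i))"
    using measure_finite_Union[OF K, of I lborel] by blast
  also have "\<dots> = (\<Sum>i\<in>K. b i - a i)" by (intro sum.cong refl meas)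
  finally have eq: "measure lborel (\<Union>i\<in>K. I i) = (\<Sum>i\<in>K. b i - a i)" .
  have "measure lborel (\<Union>i\<in>K. I i) \<le> measure lborel {0..4*pi}"
  proof (rule measure_mono_fmeasurable)
    show "(\<Union>i\<in>K. I i) \<subseteq> {0..4*pi}"
    proof (intro UN_least subsetI)
      fix i z assume "i \<in> K" "z \<in> I i"
      then show "z \<in> {0..4*pi}" using n[of i] ab(2)[of i] by (auto simp: I_def)
    qed
    show "(\<Union>i\<in>K. I i) \<in> sets lborel" using K by (auto simp: I_def)
  qed (simp add: fmeasurable_def)
  then show ?thesis unfolding eq by simp
qed

context circle_group
begin

lemma lift_le: "g \<in> G \<Longrightarrow> lift g F \<Longrightarrow> F s \<le> F t \<longleftrightarrow> s \<le> t"
  using lift_mono[of g F t s] by (simp add: linorder_not_less[symmetric])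

lemma inv_nat_pow:
  assumes "f \<in> G"
  shows "(inv\<^bsub>M\<^esub> f) [^]\<^bsub>M\<^esub> (n::nat) = f [^]\<^bsub>M\<^esub> (- int n)"
  using assms subset by (simp add: M.int_pow_neg_int M.nat_pow_inv subset_iff)

lemma lift_int_pow_neg:
  assumes "f \<in> G" "lift (inv\<^bsub>M\<^esub> f) H"
  shows "lift (f [^]\<^bsub>M\<^esub> (- int n)) (H ^^ n)"
  using lift_nat_pow[OF _ assms(2)] assms(1) by (simp add: inv_nat_pow[symmetric])

text \<open>By the chain rule the logarithm of the derivative of a power is a sum along the orbit;
  the two orbits are compared term by term.\<close>

lemma ln_deriv_pow_diff:
  assumes f: "f \<in> G" "lift f F"
    and D: "\<And>a b. \<bar>ln (angular_deriv f (cis a)) - ln (angular_deriv f (cis b))\<bar> \<le> D * \<bar>a - b\<bar>"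
  shows "\<bar>ln (angular_deriv (f [^]\<^bsub>M\<^esub> (n::nat)) (cis s)) - ln (angular_deriv (f [^]\<^bsub>M\<^esub> n) (cis t))\<bar>
     \<le> D * (\<Sum>i<n. \<bar>(F ^^ i) s - (F ^^ i) t\<bar>)"
proof (induction n arbitrary: s t)
  case 0
  then show ?case by (simp add: ad_one)
next
  case (Suc n)
  let ?a = "\<lambda>g t. angular_deriv g (cis t)"
  have p: "f [^]\<^bsub>M\<^esub> n \<in> G" by (rule nat_pow_mem[OF f(1)])
  have "ln (?a (f [^]\<^bsub>M\<^esub> Suc n) u) = ln (?a (f [^]\<^bsub>M\<^esub> n) (F u)) + ln (?a f u)" for u
    using ad_cis_pos[OF p, of "F u"] ad_cis_pos[OF f(1), of u]
    by (simp add: ad_mult[OF p f(1)] lift_cis[OF f(2)] ln_mult)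
  then have "\<bar>ln (?a (f [^]\<^bsub>M\<^esub> Suc n) s) - ln (?a (f [^]\<^bsub>M\<^esub> Suc n) t)\<bar>
      \<le> \<bar>ln (?a (f [^]\<^bsub>M\<^esub> n) (F s)) - ln (?a (f [^]\<^bsub>M\<^esub> n) (F t))\<bar> + \<bar>ln (?a f s) - ln (?a f t)\<bar>"
    by simp
  also have "\<dots> \<le> D * (\<Sum>i<n. \<bar>(F ^^ i) (F s) - (F ^^ i) (F t)\<bar>) + D * \<bar>s - t\<bar>"
    by (intro add_mono Suc.IH D)
  also have "\<dots> = D * (\<Sum>i<Suc n. \<bar>(F ^^ i) s - (F ^^ i) t\<bar>)"
    unfolding sum.lessThan_Suc_shift by (simp add: funpow_swap1 algebra_simps)
  finally show ?case .
qed

text \<open>Under this condition the images of the arc from \<open>cis a\<close> to \<open>cis b\<close> under \<open>f\<^sup>0, \<dots>, f\<^sup>n\<^sup>-\<^sup>1\<close> are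
  disjoint, because of two arcs that meet one contains the left endpoint of the other.\<close>

definition no_return :: "(complex \<Rightarrow> complex) \<Rightarrow> real \<Rightarrow> real \<Rightarrow> nat \<Rightarrow> bool" where
  "no_return f a b n \<longleftrightarrow>
    (\<forall>k::int. \<forall>K. 0 < \<bar>k\<bar> \<longrightarrow> \<bar>k\<bar> < int n \<longrightarrow> lift (f [^]\<^bsub>M\<^esub> k) K \<longrightarrow> K a \<notin> {a..<b})"

text \<open>The condition ranges over both signs of the exponent, and inverting \<open>f\<close>
  only swaps them.\<close>

lemma no_return_inv:
  assumes f: "f \<in> G" and "no_return f a b n"
  shows "no_return (inv\<^bsub>M\<^esub> f) a b n"
  unfolding no_return_def
proof (intro allI impI)
  fix k :: int and K
  assume k: "0 < \<bar>k\<bar>" "\<bar>k\<bar> < int n" and K: "lift ((inv\<^bsub>M\<^esub> f) [^]\<^bsub>M\<^esub> k) K"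
  have "f \<in> carrier M" using f subset by (rule subsetD[rotated])
  then have "(inv\<^bsub>M\<^esub> f) [^]\<^bsub>M\<^esub> k = f [^]\<^bsub>M\<^esub> (- k)"
    by (simp add: M.int_pow_inv M.int_pow_neg)
  then show "K a \<notin> {a..<b}"
    using assms(2)[unfolded no_return_def, rule_format, of "- k" K] k K by simp
qed

text \<open>If two images overlap, pulling back by the smaller power makes the arc overlap a
  translate of its image under some \<open>f^k\<close>. Either the left endpoint of that image lies
  in the arc, excluded for the exponent \<open>k\<close>, or \<open>a\<close> lies in the image and
  its preimage lies in the arc, excluded for \<open>- k\<close>.\<close>

lemma sum_iterates_le:
  assumes f: "f \<in> G" "lift f F" and ab: "a < b" "b \<le> a + 2 * pi" and nr: "no_return f a b n"
  shows "(\<Sum>i<n. (F ^^ i) b - (F ^^ i) a) \<le> 4 * pi"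
proof (rule sum_lengths_disjoint_mod_period)
  have lp: "lift (f [^]\<^bsub>M\<^esub> i) (F ^^ i)" for i :: nat by (rule lift_nat_pow[OF f])
  note mem = nat_pow_mem[OF f(1)]
  show "(F ^^ i) a \<le> (F ^^ i) b" for i
    using lift_le[OF mem lp] ab(1) by simp
  show "(F ^^ i) b \<le> (F ^^ i) a + 2 * pi" for i
    using lift_le[OF mem lp, of i b "a + 2 * pi"] lift_period[OF mem lp, of i a 1] ab(2) by simp
  obtain H where H: "lift (inv\<^bsub>M\<^esub> f) H" and HF: "\<And>t. H (F t) = t" and FH: "\<And>t. F (H t) = t"
    using lift_inv[OF f] by blast
  have HFp: "(H ^^ i) ((F ^^ i) t) = t" for i t
    by (induction i arbitrary: t) (simp_all add: funpow_swap1 HF)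
  have FHp: "(F ^^ i) ((H ^^ i) t) = t" for i t
    by (induction i arbitrary: t) (simp_all add: funpow_swap1 FH)
  have *: False
    if ij: "i < j" "j < n" and z: "(F ^^ i) a < z" "z < (F ^^ i) b"
      "(F ^^ j) a + 2 * pi * of_int m < z" "z < (F ^^ j) b + 2 * pi * of_int m" for i j z and m :: int
  proof -
    define k where "k = j - i"
    have j: "j = i + k" and k: "0 < k" "k < n" using ij by (auto simp: k_def)
    define z' where "z' = (H ^^ i) z"
    have zz: "z = (F ^^ i) z'" by (simp add: z'_def FHp)
    have shift: "(F ^^ i) (t + 2 * pi * of_int m) = (F ^^ i) t + 2 * pi * of_int m" for t
      by (rule lift_period[OF mem lp])
    have z': "a < z'" "z' < b" "(F ^^ k) a + 2 * pi * of_int m < z'" "z' < (F ^^ k) b + 2 * pi * of_int m"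
      using z unfolding zz j funpow_add o_def shift[symmetric] lift_mono[OF mem lp] by auto
    have "lift (f [^]\<^bsub>M\<^esub> (int k)) (\<lambda>t. (F ^^ k) t + 2 * pi * of_int m)"
      unfolding int_pow_int by (rule lift_shift[OF lp])
    then have "(F ^^ k) a + 2 * pi * of_int m \<notin> {a..<b}"
      using nr[unfolded no_return_def, rule_format, of "int k" "\<lambda>t. (F ^^ k) t + 2 * pi * of_int m"] k
      by simp
    then have "(F ^^ k) a + 2 * pi * of_int m < a" using z' by auto
    then have "(F ^^ k) a < a + 2 * pi * of_int (- m)" "a + 2 * pi * of_int (- m) < (F ^^ k) b"
      using z' by auto
    moreover have "a + 2 * pi * of_int (- m) = (F ^^ k) ((H ^^ k) a + 2 * pi * of_int (- m))"
      unfolding lift_period[OF mem lp] FHp ..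
    ultimately have "(H ^^ k) a + 2 * pi * of_int (- m) \<in> {a..<b}"
      using lift_mono[OF mem lp] by simp
    moreover have "lift (f [^]\<^bsub>M\<^esub> (- int k)) (\<lambda>t. (H ^^ k) t + 2 * pi * of_int (- m))"
      by (rule lift_shift[OF lift_int_pow_neg[OF f(1) H]])
    ultimately show False
      using nr[unfolded no_return_def, rule_format, of "- int k" "\<lambda>t. (H ^^ k) t + 2 * pi * of_int (- m)"] k
      by simp
  qed
  show False if ij: "i \<in> {..<n}" "j \<in> {..<n}" "i \<noteq> j" and z: "(F ^^ i) a < z" "z < (F ^^ i) b"
      "(F ^^ j) a + 2 * pi * of_int m < z" "z < (F ^^ j) b + 2 * pi * of_int m" for i j z and m :: int
  proof (cases "i < j")
    case True
    with ij(2) z show False by (intro *[of i j z m]) simp_all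
  next
    \<comment> \<open>Exchanging \<open>i\<close> and \<open>j\<close> means viewing the overlap one
      translation earlier, at \<open>z - 2 * pi * of_int m\<close>.\<close>
    case False
    with ij z show False
      by (intro *[of j i "z - 2 * pi * of_int m" "- m"]) simp_all
  qed
qed simp

text \<open>Distortion is at most the Lipschitz constant times the total length of the images, and
  disjointness bounds that length by 4 pi, uniformly in \<open>n\<close> and in the arc.\<close>

lemma denjoy_distortion:
  assumes f: "f \<in> G"
  shows "\<exists>V. \<forall>a b n s t. a < b \<longrightarrow> b \<le> a + 2 * pi \<longrightarrow> no_return f a b n \<longrightarrow> s \<in> {a..b} \<longrightarrow> t \<in> {a..b} \<longrightarrow>
    \<bar>ln (angular_deriv (f [^]\<^bsub>M\<^esub> n) (cis s)) - ln (angular_deriv (f [^]\<^bsub>M\<^esub> n) (cis t))\<bar> \<le> V"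
proof -
  obtain D where D: "D \<ge> 0"
    "\<And>a b. \<bar>ln (angular_deriv f (cis a)) - ln (angular_deriv f (cis b))\<bar> \<le> D * \<bar>a - b\<bar>"
    using ln_angular_deriv_Lipschitz[OF diffeo[OF f]] by blast
  obtain F where F: "lift f F" using lift_ex[OF f] by blast
  show ?thesis
  proof (intro exI[of _ "D * (4 * pi)"] allI impI)
    fix a b n s t
    assume ab: "a < b" "b \<le> a + 2 * pi" "no_return f a b n" and st: "s \<in> {a..b}" "t \<in> {a..b}"
    have "\<bar>ln (angular_deriv (f [^]\<^bsub>M\<^esub> n) (cis s)) - ln (angular_deriv (f [^]\<^bsub>M\<^esub> n) (cis t))\<bar>
        \<le> D * (\<Sum>i<n. \<bar>(F ^^ i) s - (F ^^ i) t\<bar>)"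
      by (rule ln_deriv_pow_diff[OF f F D(2)])
    also have "\<dots> \<le> D * (\<Sum>i<n. (F ^^ i) b - (F ^^ i) a)"
    proof (intro mult_left_mono D(1) sum_mono)
      fix i
      have "(F ^^ i) a \<le> (F ^^ i) u \<and> (F ^^ i) u \<le> (F ^^ i) b" if "u \<in> {a..b}" for u
        using that lift_le[OF nat_pow_mem[OF f] lift_nat_pow[OF f F]] by simp
      from this[OF st(1)] this[OF st(2)]
      show "\<bar>(F ^^ i) s - (F ^^ i) t\<bar> \<le> (F ^^ i) b - (F ^^ i) a" by linarith
    qed
    also have "\<dots> \<le> D * (4 * pi)"
      by (intro mult_left_mono D(1) sum_iterates_le[OF f F ab])
    finally show "\<bar>ln (angular_deriv (f [^]\<^bsub>M\<^esub> n) (cis s)) - ln (angular_deriv (f [^]\<^bsub>M\<^esub> n) (cis t))\<bar>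
        \<le> D * (4 * pi)" .
  qed
qed


section \<open>Elements whose powers expand at a point\<close>

abbreviation dpow :: "(complex \<Rightarrow> complex) \<Rightarrow> real \<Rightarrow> int \<Rightarrow> real" where
  "dpow f t k \<equiv> angular_deriv (f [^]\<^bsub>M\<^esub> k) (cis t)"

lemma carrierI: "g \<in> G \<Longrightarrow> g \<in> carrier M"
  using subset by (rule subsetD)

lemma deriv_inverse_power:
  assumes f: "f \<in> G" and K: "lift (f [^]\<^bsub>M\<^esub> k) K"
  shows "dpow f (K t) (- k) * dpow f t k = 1"
proof -
  have "f [^]\<^bsub>M\<^esub> (- k) \<otimes>\<^bsub>M\<^esub> f [^]\<^bsub>M\<^esub> k = f [^]\<^bsub>M\<^esub> (- k + k)"
    by (rule M.int_pow_mult[symmetric, OF carrierI[OF f]])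
  then have "f [^]\<^bsub>M\<^esub> (- k) \<otimes>\<^bsub>M\<^esub> f [^]\<^bsub>M\<^esub> k = \<one>\<^bsub>M\<^esub>" by simp
  then have "1 = angular_deriv (f [^]\<^bsub>M\<^esub> (- k) \<otimes>\<^bsub>M\<^esub> f [^]\<^bsub>M\<^esub> k) (cis t)" by (simp only: ad_one)
  also have "\<dots> = dpow f (K t) (- k) * dpow f t k"
    unfolding ad_mult[OF int_pow_mem[OF f] int_pow_mem[OF f]] lift_cis[OF K] ..
  finally show ?thesis ..
qed

lemma deriv_pow_fixed:
  assumes g: "g \<in> G" "g (cis t) = cis t"
  shows "angular_deriv (g [^]\<^bsub>M\<^esub> (n::nat)) (cis t) = angular_deriv g (cis t) ^ n"
proof (induction n)
  case 0
  then show ?case by (simp add: ad_one)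
next
  case (Suc n)
  then show ?case by (simp add: ad_mult[OF nat_pow_mem[OF g(1)] g(1)] g(2))
qed

text \<open>If \<open>f^k\<close> fixed the point, one of \<open>f^k\<close> and
  \<open>f^(-k)\<close> would have derivative at most 1 there, and so would all its powers:
  infinitely many exponents in one sublevel set.\<close>

lemma expanding_imp_free:
  assumes f: "f \<in> G" and expanding: "\<And>C. finite {k. dpow f t k \<le> C}"
    and k: "(k::int) \<noteq> 0" and K: "lift (f [^]\<^bsub>M\<^esub> k) K"
  shows "K t \<noteq> t"
proof
  assume Kt: "K t = t"
  have *: False if k: "k \<noteq> 0" and fx: "(f [^]\<^bsub>M\<^esub> k) (cis t) = cis t" and le: "dpow f t k \<le> 1" for k :: int
  proof -
    have "dpow f t (k * int n) \<le> 1" for n :: nat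
    proof -
      have "f [^]\<^bsub>M\<^esub> (k * int n) = (f [^]\<^bsub>M\<^esub> k) [^]\<^bsub>M\<^esub> n"
        using M.int_pow_pow[OF carrierI[OF f], of k "int n"] by (simp add: int_pow_int)
      then have "dpow f t (k * int n) = dpow f t k ^ n"
        using deriv_pow_fixed[OF int_pow_mem[OF f] fx, of n] by simp
      also have "\<dots> \<le> 1" using le ad_cis_pos[OF int_pow_mem[OF f], of k t] by (intro power_le_one) auto
      finally show ?thesis .
    qed
    then have "range (\<lambda>n::nat. k * int n) \<subseteq> {k. dpow f t k \<le> 1}" by blast
    then have "finite (range (\<lambda>n::nat. k * int n))" by (rule finite_subset[OF _ expanding])
    moreover have "inj (\<lambda>n::nat. k * int n)" using k by (auto intro!: injI)
    ultimately show False using finite_imageD infinite_UNIV_nat by blast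
  qed
  have fx: "(f [^]\<^bsub>M\<^esub> k) (cis t) = cis t" using lift_cis[OF K, of t] Kt by simp
  obtain H where H: "lift (inv\<^bsub>M\<^esub> (f [^]\<^bsub>M\<^esub> k)) H" "H (K t) = t"
    using lift_inv[OF int_pow_mem[OF f] K] by blast
  have "lift (f [^]\<^bsub>M\<^esub> (- k)) H" using H(1) by (simp add: M.int_pow_neg[OF carrierI[OF f]])
  from lift_cis[OF this, of t] have fx': "(f [^]\<^bsub>M\<^esub> (- k)) (cis t) = cis t"
    using H(2) Kt by simp
  have 1: "dpow f t (- k) * dpow f t k = 1"
    using deriv_inverse_power[OF f K, of t] Kt by simp
  show False
  proof (cases "dpow f t k \<le> 1")
    case True
    show False by (rule *[OF k fx True])
  next
    case False
    have "dpow f t (- k) \<le> 1"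
    proof (rule ccontr)
      assume "\<not> ?thesis"
      with False have "1 * 1 < dpow f t (- k) * dpow f t k"
        by (intro mult_strict_mono) auto
      with 1 show False by simp
    qed
    then show False using *[of "- k"] k fx' by simp
  qed
qed

lemma finite_shifts: "finite {c + 2 * pi * of_int m | m::int. lo < c + 2 * pi * of_int m \<and> c + 2 * pi * of_int m < hi}"
proof -
  have "{m::int. lo < c + 2 * pi * of_int m \<and> c + 2 * pi * of_int m < hi}
      \<subseteq> {\<lfloor>(lo - c) / (2 * pi)\<rfloor>..\<lceil>(hi - c) / (2 * pi)\<rceil>}"
  proof
    fix m :: int assume "m \<in> {m. lo < c + 2 * pi * of_int m \<and> c + 2 * pi * of_int m < hi}"
    then have "(lo - c) / (2 * pi) < m" "m < (hi - c) / (2 * pi)"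
      by (simp_all add: field_simps)
    then show "m \<in> {\<lfloor>(lo - c) / (2 * pi)\<rfloor>..\<lceil>(hi - c) / (2 * pi)\<rceil>}"
      by (simp add: floor_le_iff le_ceiling_iff)
  qed
  then have "finite {m::int. lo < c + 2 * pi * of_int m \<and> c + 2 * pi * of_int m < hi}"
    by (rule finite_subset) simp
  then show ?thesis by (rule finite_image_set)
qed

text \<open>The derivatives of \<open>f\<^sup>-\<^sup>q\<close> at the two endpoints \<open>t\<close> and \<open>K t\<close> of the arc are comparable, and the
  one at \<open>K t\<close> is the reciprocal of the derivative of \<open>f\<^sup>q\<close> at \<open>t\<close>.\<close>

lemma denjoy_return:
  assumes f: "f \<in> G"
  shows "\<exists>V. \<forall>t (q::int) K. q \<noteq> 0 \<longrightarrow> lift (f [^]\<^bsub>M\<^esub> q) K \<longrightarrow> t < K t \<longrightarrow> K t \<le> t + 2 * pi \<longrightarrow>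
    no_return f t (K t) (nat \<bar>q\<bar>) \<longrightarrow> dpow f t q * dpow f t (- q) \<le> exp V"
proof -
  have i: "inv\<^bsub>M\<^esub> f \<in> G" using f by simp
  obtain V1 where V1: "\<And>a b n s t. a < b \<Longrightarrow> b \<le> a + 2 * pi \<Longrightarrow> no_return f a b n \<Longrightarrow> s \<in> {a..b} \<Longrightarrow> t \<in> {a..b} \<Longrightarrow>
    \<bar>ln (angular_deriv (f [^]\<^bsub>M\<^esub> n) (cis s)) - ln (angular_deriv (f [^]\<^bsub>M\<^esub> n) (cis t))\<bar> \<le> V1"
    using denjoy_distortion[OF f] by blast
  obtain V2 where V2: "\<And>a b n s t. a < b \<Longrightarrow> b \<le> a + 2 * pi \<Longrightarrow> no_return (inv\<^bsub>M\<^esub> f) a b n \<Longrightarrow> s \<in> {a..b} \<Longrightarrow> t \<in> {a..b} \<Longrightarrow>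
    \<bar>ln (angular_deriv ((inv\<^bsub>M\<^esub> f) [^]\<^bsub>M\<^esub> n) (cis s)) - ln (angular_deriv ((inv\<^bsub>M\<^esub> f) [^]\<^bsub>M\<^esub> n) (cis t))\<bar> \<le> V2"
    using denjoy_distortion[OF i] by blast
  show ?thesis
  proof (intro exI[of _ "max V1 V2"] allI impI)
    fix t :: real and q :: int and K
    assume q: "q \<noteq> 0" and K: "lift (f [^]\<^bsub>M\<^esub> q) K" and t: "t < K t" "K t \<le> t + 2 * pi"
      and nr: "no_return f t (K t) (nat \<bar>q\<bar>)"
    have mem: "t \<in> {t..K t}" "K t \<in> {t..K t}" using t by auto
    have "\<bar>ln (dpow f t (- q)) - ln (dpow f (K t) (- q))\<bar> \<le> max V1 V2"
    \<comment> \<open>The distortion bound concerns natural powers, so \<open>f^(-q)\<close> is read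
      as a power of the inverse of \<open>f\<close> or of \<open>f\<close> itself according to the
      sign of \<open>q\<close>.\<close>
    proof (cases "q > 0")
      case True
      have "(inv\<^bsub>M\<^esub> f) [^]\<^bsub>M\<^esub> nat \<bar>q\<bar> = f [^]\<^bsub>M\<^esub> (- q)"
        using True by (simp add: inv_nat_pow[OF f])
      then show ?thesis using V2[OF t no_return_inv[OF f nr] mem] by simp
    next
      case False
      have "f [^]\<^bsub>M\<^esub> nat \<bar>q\<bar> = f [^]\<^bsub>M\<^esub> int (nat \<bar>q\<bar>)" by (simp only: int_pow_int)
      also have "int (nat \<bar>q\<bar>) = - q" using False by simp
      finally show ?thesis using V1[OF t nr mem] by simp
    qed
    then have "ln (dpow f t (- q)) - ln (dpow f (K t) (- q)) \<le> max V1 V2" by linarith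
    moreover have pos: "dpow f s k > 0" for s k by (rule ad_cis_pos[OF int_pow_mem[OF f]])
    have "ln (dpow f (K t) (- q) * dpow f t q) = ln (dpow f (K t) (- q)) + ln (dpow f t q)"
      using pos[of "- q" "K t"] pos[of q t] by (simp add: ln_mult)
    then have "ln (dpow f (K t) (- q)) + ln (dpow f t q) = 0"
      unfolding deriv_inverse_power[OF f K] by simp
    ultimately have "ln (dpow f t q * dpow f t (- q)) \<le> max V1 V2"
      using pos[of "- q" t] pos[of q t] by (simp add: ln_mult)
    then have "exp (ln (dpow f t q * dpow f t (- q))) \<le> exp (max V1 V2)" by simp
    moreover have "dpow f t q * dpow f t (- q) > 0" using pos by (rule mult_pos_pos) (rule pos)
    ultimately show "dpow f t q * dpow f t (- q) \<le> exp (max V1 V2)" by simp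
  qed
qed

text \<open>Closest returns to \<open>t\<close> from the right have bounded exponents, so some arc
  from \<open>t\<close> to \<open>b\<close> is never re-entered by the orbit of \<open>t\<close>.
  Its forward images are disjoint modulo the period, yet their lengths have a common positive lower
  bound.\<close>

lemma not_expanding_powers:
  assumes f: "f \<in> G" and expanding: "\<And>C. finite {k. dpow f t k \<le> C}"
  shows False
proof -
  have pos: "dpow f s k > 0" for s k by (rule ad_cis_pos[OF int_pow_mem[OF f]])
  obtain V where V: "\<And>t (q::int) K. q \<noteq> 0 \<Longrightarrow> lift (f [^]\<^bsub>M\<^esub> q) K \<Longrightarrow> t < K t \<Longrightarrow> K t \<le> t + 2 * pi \<Longrightarrow>
      no_return f t (K t) (nat \<bar>q\<bar>) \<Longrightarrow> dpow f t q * dpow f t (- q) \<le> exp V"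
    using denjoy_return[OF f] by blast
  \<comment> \<open>Only finitely many derivatives are at most 1, so all of them have a positive
    lower bound.\<close>
  obtain c where c: "c > 0" "\<And>k. dpow f t k \<ge> c"
  proof
    define A where "A = insert 1 (dpow f t ` {k. dpow f t k \<le> 1})"
    have A: "finite A" "A \<noteq> {}" using expanding[of 1] by (auto simp: A_def)
    show "Min A > 0" using A pos by (simp add: A_def)
    fix k show "dpow f t k \<ge> Min A"
    proof (cases "dpow f t k \<le> 1")
      case True
      then have "dpow f t k \<in> A" by (auto simp: A_def)
      then show ?thesis by (rule Min_le[OF A(1)])
    next
      case False
      have "Min A \<le> 1" by (rule Min_le[OF A(1)]) (simp add: A_def)
      with False show ?thesis by simp
    qed
  qed
  \<comment> \<open>Every exponent of a closest return lies in \<open>E\<close>. One factor of the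
    product is at least \<open>c\<close>, so the other is bounded, and expansion makes
    \<open>E\<close> finite.\<close>
  define E where "E = {q. dpow f t q * dpow f t (- q) \<le> exp V}"
  have "E \<subseteq> {q. dpow f t q \<le> exp V / c}"
  proof
    fix q assume "q \<in> E"
    moreover have "dpow f t q * c \<le> dpow f t q * dpow f t (- q)"
      using c(2) less_imp_le[OF pos] by (rule mult_left_mono)
    ultimately have "dpow f t q * c \<le> exp V" by (simp add: E_def)
    then show "q \<in> {q. dpow f t q \<le> exp V / c}" using c(1) by (simp add: pos_le_divide_eq)
  qed
  then have finE: "finite E" by (rule finite_subset[OF _ expanding])
  define Q where "Q = Max (insert 0 ((\<lambda>q. \<bar>q\<bar>) ` E))"
  have Q: "\<bar>q\<bar> \<le> Q" if "q \<in> E" for q unfolding Q_def using finE that by (intro Max_ge) auto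
  define Z where "Z = (\<Union>k\<in>{k. k \<noteq> 0 \<and> \<bar>k\<bar> \<le> Q}. {K t |K. lift (f [^]\<^bsub>M\<^esub> k) K \<and> t < K t \<and> K t < t + 2 * pi})"
  have "finite Z"
    unfolding Z_def
  proof (rule finite_UN_I)
    have "{k. k \<noteq> 0 \<and> \<bar>k\<bar> \<le> Q} \<subseteq> {- Q..Q}" by auto
    then show "finite {k. k \<noteq> 0 \<and> \<bar>k\<bar> \<le> Q}" by (rule finite_subset) simp
    fix k :: int
    obtain K0 where K0: "lift (f [^]\<^bsub>M\<^esub> k) K0" using lift_ex[OF int_pow_mem[OF f]] by blast
    have "{K t |K. lift (f [^]\<^bsub>M\<^esub> k) K \<and> t < K t \<and> K t < t + 2 * pi}
      \<subseteq> {K0 t + 2 * pi * of_int m | m::int. t < K0 t + 2 * pi * of_int m \<and> K0 t + 2 * pi * of_int m < t + 2 * pi}"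
    proof
      fix z assume "z \<in> {K t |K. lift (f [^]\<^bsub>M\<^esub> k) K \<and> t < K t \<and> K t < t + 2 * pi}"
      then obtain K where K: "lift (f [^]\<^bsub>M\<^esub> k) K" "t < K t" "K t < t + 2 * pi" "z = K t" by blast
      obtain m :: int where "K = (\<lambda>t. K0 t + 2 * pi * m)" using lift_unique[OF K0 K(1)] by blast
      with K show "z \<in> {K0 t + 2 * pi * of_int m | m::int. t < K0 t + 2 * pi * of_int m \<and> K0 t + 2 * pi * of_int m < t + 2 * pi}"
        by blast
    qed
    then show "finite {K t |K. lift (f [^]\<^bsub>M\<^esub> k) K \<and> t < K t \<and> K t < t + 2 * pi}"
      by (rule finite_subset[OF _ finite_shifts])
  qed
  \<comment> \<open>The nearest point to the right of \<open>t\<close> reached by an exponent of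
    size at most \<open>Q\<close>; the extra element \<open>t + 2 * pi\<close> covers the case that
    there is none and keeps the arc within one period.\<close>
  define b where "b = Min (insert (t + 2 * pi) Z)"
  have b2: "b \<le> t + 2 * pi" and bZ: "\<And>z. z \<in> Z \<Longrightarrow> b \<le> z"
    unfolding b_def using \<open>finite Z\<close> by (auto intro: Min_le)
  have b1: "t < b" unfolding b_def using \<open>finite Z\<close> by (auto simp: Z_def)
  \<comment> \<open>Induction on the size of the exponent: when all smaller exponents miss the arc,
    a return is a closest one, so its exponent lies in \<open>E\<close> and its point in
    \<open>Z\<close>, where nothing is below \<open>b\<close>.\<close>
  have nob: "K t \<notin> {t..<b}" if "k \<noteq> 0" "lift (f [^]\<^bsub>M\<^esub> k) K" for k :: int and K
    using that
  proof (induction "nat \<bar>k\<bar>" arbitrary: k K rule: less_induct)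
    case less
    show ?case
    proof
      assume Kt: "K t \<in> {t..<b}"
      moreover have "K t \<noteq> t" by (rule expanding_imp_free[OF f expanding less.prems])
      ultimately have K: "t < K t" "K t < b" by auto
      have "no_return f t (K t) (nat \<bar>k\<bar>)"
        unfolding no_return_def
      proof (intro allI impI)
        fix l :: int and L assume l: "0 < \<bar>l\<bar>" "\<bar>l\<bar> < int (nat \<bar>k\<bar>)" "lift (f [^]\<^bsub>M\<^esub> l) L"
        have "L t \<notin> {t..<b}" by (rule less.hyps) (use l in auto)
        then show "L t \<notin> {t..<K t}" using K by auto
      qed
      then have "dpow f t k * dpow f t (- k) \<le> exp V"
        using K b2 by (intro V[OF less.prems]) auto
      then have "\<bar>k\<bar> \<le> Q" using Q by (simp add: E_def)
      then have "K t \<in> Z" unfolding Z_def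
        using K b2 less.prems by (intro UN_I[of k] CollectI exI[of _ K]) auto
      from bZ[OF this] K show False by simp
    qed
  qed
  have nr: "no_return f t b n" for n
    unfolding no_return_def using nob by simp
  obtain V1 where V1: "\<And>a b n s t. a < b \<Longrightarrow> b \<le> a + 2 * pi \<Longrightarrow> no_return f a b n \<Longrightarrow> s \<in> {a..b} \<Longrightarrow> t \<in> {a..b} \<Longrightarrow>
    \<bar>ln (angular_deriv (f [^]\<^bsub>M\<^esub> n) (cis s)) - ln (angular_deriv (f [^]\<^bsub>M\<^esub> n) (cis t))\<bar> \<le> V1"
    using denjoy_distortion[OF f] by blast
  obtain F where F: "lift f F" using lift_ex[OF f] by blast
  \<comment> \<open>By the mean value theorem an image has length \<open>b - t\<close> times a
    derivative at an inner point; that derivative is at least \<open>exp (- V1)\<close> times the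
    one at \<open>t\<close>, which is at least \<open>c\<close>.\<close>
  define d where "d = exp (- V1) * c * (b - t)"
  have d: "d > 0" unfolding d_def using c b1 by simp
  have len: "(F ^^ n) b - (F ^^ n) t \<ge> d" for n
  proof -
    let ?p = "f [^]\<^bsub>M\<^esub> n"
    have p: "?p \<in> G" by (rule nat_pow_mem[OF f])
    have "\<exists>z>t. z < b \<and> (F ^^ n) b - (F ^^ n) t = (b - t) * angular_deriv ?p (cis z)"
      by (rule MVT2[OF b1]) (rule lift_has_derivative[OF lift_nat_pow[OF f F]])
    then obtain z where z: "t < z" "z < b" "(F ^^ n) b - (F ^^ n) t = (b - t) * angular_deriv ?p (cis z)"
      by blast
    have "\<bar>ln (angular_deriv ?p (cis t)) - ln (angular_deriv ?p (cis z))\<bar> \<le> V1"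
      by (rule V1[OF b1 b2 nr]) (use z b1 in auto)
    then have "ln (angular_deriv ?p (cis t)) - V1 \<le> ln (angular_deriv ?p (cis z))" by linarith
    then have "exp (ln (angular_deriv ?p (cis t)) - V1) \<le> exp (ln (angular_deriv ?p (cis z)))" by simp
    then have "angular_deriv ?p (cis t) * exp (- V1) \<le> angular_deriv ?p (cis z)"
      using ad_cis_pos[OF p] by (simp add: exp_diff exp_minus divide_inverse)
    moreover have "c * exp (- V1) \<le> angular_deriv ?p (cis t) * exp (- V1)"
      using c(2)[of "int n"] unfolding int_pow_int by (intro mult_right_mono) auto
    ultimately have "c * exp (- V1) \<le> angular_deriv ?p (cis z)" by linarith
    then have "(b - t) * (c * exp (- V1)) \<le> (b - t) * angular_deriv ?p (cis z)"
      using b1 by (intro mult_left_mono) auto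
    then show ?thesis unfolding z(3) d_def by (simp add: mult_ac)
  qed
  obtain n :: nat where n: "4 * pi / d < n" using reals_Archimedean2 by blast
  have "real n * d \<le> (\<Sum>i<n. (F ^^ i) b - (F ^^ i) t)"
    using sum_bounded_below[of "{..<n}" d "\<lambda>i. (F ^^ i) b - (F ^^ i) t"] len by simp
  also have "\<dots> \<le> 4 * pi" by (rule sum_iterates_le[OF f F b1 b2 nr])
  finally show False using n d by (simp add: pos_divide_less_eq)
qed

end

subsection \<open>Torsion groups\<close>

text \<open>Adjoining a commuting generator \<open>s\<close> with \<open>s [^] n = \<one>\<close>
  produces only products of a power of \<open>s\<close> below \<open>n\<close> with an element of
  the previous group; this normal form is preserved by multiplication.\<close>

lemma (in group) finite_generate_torsion_commute:
  assumes "finite S" "S \<subseteq> carrier G"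
    and "\<And>x y. x \<in> generate G S \<Longrightarrow> y \<in> generate G S \<Longrightarrow> x \<otimes> y = y \<otimes> x"
    and "\<And>x. x \<in> S \<Longrightarrow> \<exists>n>0. x [^] (n::nat) = \<one>"
  shows "finite (generate G S)"
  using assms
proof (induction S rule: finite_induct)
  case empty
  have "generate G {} \<subseteq> {\<one>}" by (rule generate_subgroup_incl[OF _ triv_subgroup]) simp
  then show ?case by (rule finite_subset) simp
next
  case (insert s T)
  have s: "s \<in> carrier G" and T: "T \<subseteq> carrier G" using insert.prems(1) by auto
  have sub: "generate G T \<subseteq> generate G (insert s T)" by (rule mono_generate) blast
  have fin: "finite (generate G T)"
  proof (rule insert.IH[OF T])
    show "x \<otimes> y = y \<otimes> x" if "x \<in> generate G T" "y \<in> generate G T" for x y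
      using insert.prems(2) subsetD[OF sub that(1)] subsetD[OF sub that(2)] by blast
    show "\<exists>n>0. x [^] (n::nat) = \<one>" if "x \<in> T" for x
      using insert.prems(3) that by blast
  qed
  obtain n :: nat where n: "n > 0" "s [^] n = \<one>" using insert.prems(3) by blast
  have gT: "generate G T \<subseteq> carrier G" by (rule generate_incl[OF T])
  have sG: "s [^] (k::nat) \<in> generate G (insert s T)" for k
  proof (induction k)
    case 0
    then show ?case by (simp add: generate.one)
  next
    case (Suc k)
    then show ?case using generate.eng[OF Suc generate.incl[of s]] by simp
  qed
  have comm: "h \<otimes> s [^] (k::nat) = s [^] k \<otimes> h" if "h \<in> generate G T" for h k
    using insert.prems(2)[of h "s [^] k"] that sub sG by blast
  have smod: "s [^] (k::nat) = s [^] (k mod n)" for k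
  proof -
    have "s [^] k = s [^] (n * (k div n) + k mod n)" by simp
    also have "\<dots> = (s [^] n) [^] (k div n) \<otimes> s [^] (k mod n)"
      using s by (simp only: nat_pow_mult[symmetric] nat_pow_pow)
    also have "\<dots> = s [^] (k mod n)" using s by (simp add: n(2))
    finally show ?thesis .
  qed
  define B where "B = (\<lambda>(k, h). s [^] k \<otimes> h) ` ({..<n} \<times> generate G T)"
  have BI: "s [^] (k::nat) \<otimes> h \<in> B" if "h \<in> generate G T" for k h
    unfolding B_def using that n(1) smod[of k] by (intro image_eqI[of _ _ "(k mod n, h)"]) simp_all
  have "x \<in> B" if "x \<in> generate G (insert s T)" for x
    using that
  proof (induction rule: generate.induct)
    case one
    show ?case using BI[OF generate.one, of 0] by simp
  next
    case (incl h)
    show ?case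
    proof (cases "h = s")
      case True
      then show ?thesis using BI[OF generate.one, of 1] s by simp
    next
      case False
      then have h: "h \<in> T" using incl by simp
      then show ?thesis using BI[OF generate.incl[OF h], of 0] T by (simp add: subset_iff)
    qed
  next
    case (inv h)
    show ?case
    proof (cases "h = s")
      case True
      have "s [^] (n - 1) \<otimes> s = s [^] n" using n(1) nat_pow_Suc[of s "n - 1"] by simp
      then have "inv s = s [^] (n - 1)" using n(2) s by (simp add: inv_equality)
      then show ?thesis using True BI[OF generate.one, of "n - 1"] s by simp
    next
      case False
      then have h: "h \<in> T" using inv by simp
      then show ?thesis using BI[OF generate.inv[OF h], of 0] T by (simp add: subset_iff)
    qed
  next
    case (eng x y)
    have "\<exists>(k::nat) h. z = s [^] k \<otimes> h \<and> h \<in> generate G T" if "z \<in> B" for z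
      using that unfolding B_def by auto
    with eng.IH obtain k l :: nat and h j where x: "x = s [^] k \<otimes> h" "h \<in> generate G T"
      and y: "y = s [^] l \<otimes> j" "j \<in> generate G T" by blast
    have c: "h \<in> carrier G" "j \<in> carrier G" using x(2) y(2) gT by auto
    have "x \<otimes> y = s [^] k \<otimes> (h \<otimes> s [^] l) \<otimes> j"
      unfolding x(1) y(1) using c s by (simp add: m_assoc)
    also have "\<dots> = s [^] (k + l) \<otimes> (h \<otimes> j)"
      unfolding comm[OF x(2)] using c s by (simp add: m_assoc nat_pow_mult[symmetric])
    finally show ?case using BI[OF generate.eng[OF x(2) y(2)]] by simp
  qed
  moreover have "finite B" unfolding B_def using fin by (intro finite_imageI finite_cartesian_product) auto
  ultimately show ?case by (meson finite_subset subsetI)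
qed

context circle_group
begin

text \<open>\<open>F ^^ n\<close> lifts the identity and fixes \<open>p\<close>, so it is the
  identity. A monotone \<open>F\<close> that moves a point moves it further in the same direction
  under iteration and could never bring it back.\<close>

lemma torsion_fixed_point:
  assumes g: "g \<in> G" "g [^]\<^bsub>M\<^esub> (n::nat) = \<one>\<^bsub>M\<^esub>" "n > 0" and F: "lift g F" "F p = p"
  shows "F t = t" "g = \<one>\<^bsub>M\<^esub>"
proof -
  have pow: "lift \<one>\<^bsub>M\<^esub> (F ^^ n)" using lift_nat_pow[OF g(1) F(1), of n] g(2) by simp
  obtain m :: int where m: "F ^^ n = (\<lambda>t. t + 2 * pi * m)" using lift_unique[OF lift_one pow] by blast
  have "(F ^^ k) p = p" for k by (induction k) (simp_all add: F(2))
  with fun_cong[OF m, of p] have "m = 0" by simp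
  with m have id: "(F ^^ n) t = t" for t by simp
  have up: "(F ^^ Suc k) t > t" if "F t > t" for k t
  proof (induction k)
    case (Suc k)
    then have "F ((F ^^ Suc k) t) > F t" by (simp only: lift_mono[OF g(1) F(1)])
    with that show ?case by simp
  qed (use that in simp)
  have down: "(F ^^ Suc k) t < t" if "F t < t" for k t
  proof (induction k)
    case (Suc k)
    then have "F ((F ^^ Suc k) t) < F t" by (simp only: lift_mono[OF g(1) F(1)])
    with that show ?case by simp
  qed (use that in simp)
  have Ft: "F t = t" for t
    using up[of t "n - 1"] down[of t "n - 1"] id[of t] g(3) by (cases "F t" t rule: linorder_cases) auto
  show "F t = t" by (rule Ft)
  have "F = (\<lambda>t. t)" using Ft by blast
  then show "g = \<one>\<^bsub>M\<^esub>" using F(1) g(1) lift_one by (intro mem_eqI[of g _ F]) auto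
qed

text \<open>The extension of \<open>G\<close> by the translations by multiples of 2 pi. Unlike
  \<open>G\<close> it acts on a line, so its elements can be compared pointwise.\<close>

definition lifts :: "(real \<Rightarrow> real) set" where
  "lifts = {F. \<exists>g\<in>G. lift g F}"

lemma liftsI: "g \<in> G \<Longrightarrow> lift g F \<Longrightarrow> F \<in> lifts"
  unfolding lifts_def by blast

lemma liftsE:
  assumes "F \<in> lifts"
  obtains g where "g \<in> G" "lift g F"
  using assms unfolding lifts_def by blast

lemma lifts_comp: "F \<in> lifts \<Longrightarrow> H \<in> lifts \<Longrightarrow> (\<lambda>t. F (H t)) \<in> lifts"
  by (elim liftsE) (rule liftsI[OF m_closed lift_mult])

lemma lifts_inv:
  assumes "F \<in> lifts"
  obtains H where "H \<in> lifts" "\<And>t. H (F t) = t" "\<And>t. F (H t) = t"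
proof -
  obtain g where g: "g \<in> G" "lift g F" using assms by (rule liftsE)
  obtain H where "lift (inv\<^bsub>M\<^esub> g) H" "\<And>t. H (F t) = t" "\<And>t. F (H t) = t"
    using lift_inv[OF g] by blast
  with liftsI[OF m_inv_closed[OF g(1)]] that show thesis by blast
qed

lemma lifts_mono: "F \<in> lifts \<Longrightarrow> F s < F t \<longleftrightarrow> s < t"
  by (elim liftsE) (rule lift_mono)

lemma lifts_le: "F \<in> lifts \<Longrightarrow> F s \<le> F t \<longleftrightarrow> s \<le> t"
  by (elim liftsE) (rule lift_le)

lemma lifts_pow: "F \<in> lifts \<Longrightarrow> (F ^^ n) \<in> lifts"
  by (elim liftsE) (rule liftsI[OF nat_pow_mem lift_nat_pow])

lemma lifts_isCont: "F \<in> lifts \<Longrightarrow> isCont F t"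
  by (elim liftsE) (rule lift_isCont)

end

locale torsion_circle_group = circle_group +
  assumes torsion: "g \<in> G \<Longrightarrow> \<exists>n>0. g [^]\<^bsub>M\<^esub> (n::nat) = \<one>\<^bsub>M\<^esub>"
begin

lemma lifts_fixed: "F \<in> lifts \<Longrightarrow> F p = p \<Longrightarrow> F t = t"
proof (elim liftsE)
  fix g assume g: "g \<in> G" "lift g F" and p: "F p = p"
  obtain n :: nat where "n > 0" "g [^]\<^bsub>M\<^esub> n = \<one>\<^bsub>M\<^esub>" using torsion[OF g(1)] by blast
  with torsion_fixed_point(1)[OF g(1) _ _ g(2) p] show "F t = t" by blast
qed

lemma lifts_eq:
  assumes "F \<in> lifts" "H \<in> lifts" "F p = H p"
  shows "F t = H t"
proof -
  obtain F' where F': "F' \<in> lifts" "\<And>t. F' (F t) = t" "\<And>t. F (F' t) = t"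
    by (rule lifts_inv[OF assms(1)]) blast
  have "F' (H p) = p" using F'(2)[of p] assms(3) by simp
  then have "F' (H t) = t" by (rule lifts_fixed[OF lifts_comp[OF F'(1) assms(2)]])
  then show ?thesis using F'(3)[of "H t"] by simp
qed

text \<open>If the order of two lifts changed, their graphs would meet by the intermediate value
  theorem, and lifts that agree at one point agree everywhere. Comparison at a single point is
  therefore a total order.\<close>

lemma lifts_less:
  assumes FH: "F \<in> lifts" "H \<in> lifts" "F s < H s"
  shows "F t < H t"
proof (rule ccontr)
  assume c: "\<not> ?thesis"
  have cont: "isCont (\<lambda>t. F t - H t) x" for x
    by (intro continuous_intros lifts_isCont FH)
  have "\<exists>p. F p - H p = 0"
  proof (cases "s \<le> t")
    case True
    then show ?thesis using IVT[of "\<lambda>t. F t - H t" s 0 t] c FH(3) cont by auto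
  next
    case False
    then show ?thesis using IVT2[of "\<lambda>t. F t - H t" s 0 t] c FH(3) cont by auto
  qed
  then obtain p where "F p = H p" by auto
  from lifts_eq[OF FH(1,2) this, of s] FH(3) show False by simp
qed

lemma lifts_less_eq:
  assumes "F \<in> lifts" "H \<in> lifts" "F s \<le> H s"
  shows "F t \<le> H t"
  using lifts_less[OF assms(2,1), of t s] assms(3) by (meson linorder_not_less)

text \<open>By torsion some power of \<open>E\<close> is a translation by \<open>2 * pi * m\<close>,
  and \<open>m\<close> is positive because \<open>E\<close> moves \<open>t\<close> to the
  right.\<close>

lemma lifts_archimedean:
  assumes E: "E \<in> lifts" "E t > t"
  shows "\<exists>n. y < (E ^^ n) t"
proof -
  obtain e where e: "e \<in> G" "lift e E" using E(1) by (rule liftsE)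
  obtain q :: nat where q: "q > 0" "e [^]\<^bsub>M\<^esub> q = \<one>\<^bsub>M\<^esub>" using torsion[OF e(1)] by blast
  have pow: "lift \<one>\<^bsub>M\<^esub> (E ^^ q)" using lift_nat_pow[OF e, of q] q(2) by simp
  obtain m :: int where m: "E ^^ q = (\<lambda>t. t + 2 * pi * m)" using lift_unique[OF lift_one pow] by blast
  have up: "(E ^^ Suc k) t > t" for k
  proof (induction k)
    case (Suc k)
    then have "E ((E ^^ Suc k) t) > E t" by (simp only: lifts_mono[OF E(1)])
    with E(2) show ?case by simp
  qed (use E(2) in simp)
  from up[of "q - 1"] q(1) have "(E ^^ q) t > t" by simp
  with m have "m > 0" by (simp add: zero_less_mult_iff)
  have iter: "((E ^^ q) ^^ k) t = t + 2 * pi * m * real k" for k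
    by (induction k) (simp_all add: m algebra_simps)
  obtain k :: nat where k: "y - t < real k" using reals_Archimedean2 by blast
  have "1 \<le> 2 * pi * real_of_int m"
    using \<open>m > 0\<close> pi_gt3 mult_mono[of 1 "2 * pi" 1 "real_of_int m"] by simp
  then have "real k \<le> 2 * pi * m * real k" using mult_right_mono[of 1 "2 * pi * m" "real k"] by simp
  with k iter[of k] have "y < (E ^^ (q * k)) t" by (simp add: funpow_mult mult.commute)
  then show ?thesis by blast
qed

lemma lifts_between:
  assumes E: "E \<in> lifts" "E t0 > t0" and F: "F \<in> lifts" "F t0 \<ge> t0"
  shows "\<exists>a::nat. \<forall>t. (E ^^ a) t \<le> F t \<and> F t < (E ^^ Suc a) t"
proof -
  define n where "n = (LEAST n. F t0 < (E ^^ n) t0)"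
  have n: "F t0 < (E ^^ n) t0" unfolding n_def by (rule LeastI_ex[OF lifts_archimedean[OF E]])
  then have "n \<noteq> 0" using F(2) by (cases n) auto
  then obtain a where a: "n = Suc a" by (cases n) auto
  have "\<not> F t0 < (E ^^ a) t0"
    using not_less_Least[of a "\<lambda>n. F t0 < (E ^^ n) t0"] a unfolding n_def by simp
  then have "(E ^^ a) t0 \<le> F t0" by simp
  then show ?thesis
    using lifts_less_eq[OF lifts_pow[OF E(1)] F(1)] lifts_less[OF F(1) lifts_pow[OF E(1)] n] a by blast
qed

text \<open>Hoelder's argument: since nontrivial elements act freely, the lifts form an Archimedean ordered
  group. If \<open>F \<circ> H\<close> and \<open>H \<circ> F\<close> differed by \<open>C > id\<close>, an element \<open>E > id\<close> with \<open>E \<circ> E \<le> C\<close> would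
  contradict \<open>E\<^sup>a \<le> F < E\<^sup>a\<^sup>+\<^sup>1\<close> and \<open>E\<^sup>b \<le> H < E\<^sup>b\<^sup>+\<^sup>1\<close>.\<close>

lemma lifts_not_less_commute:
  assumes rec: "\<And>\<epsilon>. \<epsilon> > 0 \<Longrightarrow> infinite {g \<in> G. \<exists>F. lift g F \<and> \<bar>F t0 - t0\<bar> < \<epsilon>}"
    and F: "F \<in> lifts" "F t0 \<ge> t0" and H: "H \<in> lifts" "H t0 \<ge> t0"
  shows "\<not> H (F s) < F (H s)"
proof
  assume less: "H (F s) < F (H s)"
  obtain I where I: "I \<in> lifts" "\<And>t. I (H (F t)) = t" "\<And>t. H (F (I t)) = t"
    by (rule lifts_inv[OF lifts_comp[OF H(1) F(1)]]) blast
  \<comment> \<open>The commutator of \<open>F\<close> and \<open>H\<close>: it carries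
    \<open>H (F t)\<close> to \<open>F (H t)\<close>.\<close>
  define C where "C t = F (H (I t))" for t
  have C: "C \<in> lifts" unfolding C_def[abs_def] by (rule lifts_comp[OF lifts_comp[OF F(1) H(1)] I(1)])
  have CHF: "C (H (F t)) = F (H t)" for t by (simp add: C_def I(2))
  have id: "(\<lambda>t. t) \<in> lifts" by (rule liftsI[OF one_closed lift_one])
  have Cgt: "C t > t" for t
    using lifts_less[OF id C, of "H (F s)"] less by (simp add: CHF)
  obtain C' where C': "C' \<in> lifts" "\<And>t. C' (C t) = t" "\<And>t. C (C' t) = t"
    by (rule lifts_inv[OF C]) blast
  have C'lt: "C' t0 < t0" using Cgt[of "C' t0"] C'(3) by simp
  \<comment> \<open>With this choice \<open>J t0\<close> lies strictly between \<open>C' t0\<close>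
    and \<open>C t0\<close>, so whichever of \<open>J\<close> and its inverse moves
    \<open>t0\<close> to the right moves it less than \<open>C\<close> does. The identity is removed
    from the recurrent elements to make \<open>J\<close> move \<open>t0\<close> at all.\<close>
  define \<epsilon> where "\<epsilon> = min (C t0 - t0) (t0 - C' t0)"
  have "\<epsilon> > 0" using Cgt[of t0] C'lt by (simp add: \<epsilon>_def)
  from infinite_imp_nonempty[OF infinite_remove[OF rec[OF this], of "\<one>\<^bsub>M\<^esub>"]]
  obtain g J where g: "g \<in> G" "g \<noteq> \<one>\<^bsub>M\<^esub>" and J: "lift g J" "\<bar>J t0 - t0\<bar> < \<epsilon>"
    by blast
  have JL: "J \<in> lifts" by (rule liftsI[OF g(1) J(1)])
  have "J t0 \<noteq> t0" using torsion_fixed_point(2)[OF g(1) _ _ J(1)] torsion[OF g(1)] g(2) by blast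
  have "\<exists>E\<in>lifts. t0 < E t0 \<and> E t0 < C t0"
  proof (cases "J t0 > t0")
    case True
    then show ?thesis using JL J(2) by (intro bexI[of _ J]) (auto simp: \<epsilon>_def)
  next
    case False
    with \<open>J t0 \<noteq> t0\<close> have lt: "J t0 < t0" by simp
    obtain J' where J': "J' \<in> lifts" "\<And>t. J' (J t) = t" "\<And>t. J (J' t) = t"
      by (rule lifts_inv[OF JL]) blast
    have "C' t0 < J t0" using J(2) lt by (auto simp: \<epsilon>_def)
    then have "C' (C t0) < J (C t0)" by (rule lifts_less[OF C'(1) JL])
    then have "J (J' t0) < J (C t0)" by (simp add: C' J')
    then have "J' t0 < C t0" by (simp only: lifts_mono[OF JL])
    moreover have "J (J' t0) > J t0" using lt J' by simp
    then have "J' t0 > t0" by (simp only: lifts_mono[OF JL])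
    ultimately show ?thesis using J'(1) by blast
  qed
  then obtain E0 where E0: "E0 \<in> lifts" "t0 < E0 t0" "E0 t0 < C t0" by blast
  obtain E0' where E0': "E0' \<in> lifts" "\<And>t. E0' (E0 t) = t" "\<And>t. E0 (E0' t) = t"
    by (rule lifts_inv[OF E0(1)]) blast
  \<comment> \<open>\<open>C\<close> factors as \<open>E0\<close> after \<open>E1\<close>, so the
    smaller of the two factors has a square not exceeding \<open>C\<close>.\<close>
  define E1 where "E1 t = E0' (C t)" for t
  have E1: "E1 \<in> lifts" unfolding E1_def[abs_def] by (rule lifts_comp[OF E0'(1) C])
  have E01: "E0 (E1 t) = C t" for t by (simp add: E1_def E0')
  have "E0 (E1 t0) > E0 t0" using E0(3) E01 by simp
  then have E1gt: "E1 t0 > t0" by (simp only: lifts_mono[OF E0(1)])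
  have "\<exists>E\<in>lifts. E t0 > t0 \<and> (\<forall>t. E (E t) \<le> C t)"
  proof (cases "E0 t0 \<le> E1 t0")
    case True
    have "E0 (E0 t) \<le> E0 (E1 t)" for t
      using lifts_less_eq[OF E0(1) E1 True, of t] by (simp only: lifts_le[OF E0(1)])
    then show ?thesis using E0 E01 by (intro bexI[of _ E0]) auto
  next
    case False
    then have "E1 t0 \<le> E0 t0" by simp
    have "E1 (E1 t) \<le> E0 (E1 t)" for t
      by (rule lifts_less_eq[OF E1 E0(1) \<open>E1 t0 \<le> E0 t0\<close>])
    then show ?thesis using E1 E1gt E01 by (intro bexI[of _ E1]) auto
  qed
  then obtain E where E: "E \<in> lifts" "E t0 > t0" "\<And>t. E (E t) \<le> C t" by blast
  obtain a where a: "\<And>t. (E ^^ a) t \<le> F t" "\<And>t. F t < (E ^^ Suc a) t"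
    using lifts_between[OF E(1,2) F] by blast
  obtain b where b: "\<And>t. (E ^^ b) t \<le> H t" "\<And>t. H t < (E ^^ Suc b) t"
    using lifts_between[OF E(1,2) H] by blast
  \<comment> \<open>Both products lie within two steps of the same power of \<open>E\<close>, so
    \<open>F (H s)\<close> is strictly below \<open>E (E (H (F s)))\<close>, hence below
    \<open>C (H (F s))\<close>, which is \<open>F (H s)\<close> again.\<close>
  have "F (H s) < (E ^^ Suc a) (H s)" by (rule a(2))
  also have "\<dots> < (E ^^ Suc a) ((E ^^ Suc b) s)" unfolding lifts_mono[OF lifts_pow[OF E(1)]] by (rule b(2))
  also have "\<dots> = (E ^^ (Suc a + Suc b)) s" by (simp only: funpow_add o_apply)
  also have "Suc a + Suc b = Suc (Suc (b + a))" by simp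
  also have "(E ^^ Suc (Suc (b + a))) s = E (E ((E ^^ b) ((E ^^ a) s)))" by (simp add: funpow_add)
  also have "\<dots> \<le> E (E (H (F s)))"
  proof -
    have "(E ^^ b) ((E ^^ a) s) \<le> (E ^^ b) (F s)" unfolding lifts_le[OF lifts_pow[OF E(1)]] by (rule a(1))
    also have "\<dots> \<le> H (F s)" by (rule b(1))
    finally show ?thesis by (simp only: lifts_le[OF E(1)])
  qed
  also have "\<dots> \<le> C (H (F s))" by (rule E(3))
  finally show False by (simp add: CHF)
qed

text \<open>Adding periods gives every element a lift that does not move \<open>t0\<close> to the
  left, so the preceding lemma applies in both orders and any two such lifts commute. As
  \<open>rec\<close> makes \<open>G\<close> infinite, the conclusion is used as a
  contradiction.\<close>

lemma finite_if_recurrent: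
  assumes rec: "\<And>\<epsilon>. \<epsilon> > 0 \<Longrightarrow> infinite {g \<in> G. \<exists>F. lift g F \<and> \<bar>F t0 - t0\<bar> < \<epsilon>}"
  shows "finite G"
proof -
  have above: "\<exists>F. lift g F \<and> F t0 \<ge> t0" if g: "g \<in> G" for g
  proof -
    obtain F where F: "lift g F" using lift_ex[OF g] by blast
    obtain n :: nat where n: "t0 - F t0 < n" using reals_Archimedean2 by blast
    have "real n * 1 \<le> real n * (2 * pi)" using pi_gt3 by (intro mult_left_mono) auto
    with n have "t0 \<le> F t0 + 2 * pi * of_int (int n)" by (simp add: mult_ac)
    then show ?thesis using lift_shift[OF F, of "int n"] by blast
  qed
  have comm: "g \<otimes>\<^bsub>M\<^esub> h = h \<otimes>\<^bsub>M\<^esub> g" if g: "g \<in> G" and h: "h \<in> G" for g h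
  proof -
    obtain F where F: "lift g F" "F t0 \<ge> t0" using above[OF g] by blast
    obtain H where H: "lift h H" "H t0 \<ge> t0" using above[OF h] by blast
    have L: "F \<in> lifts" "H \<in> lifts" using liftsI[OF g F(1)] liftsI[OF h H(1)] by simp_all
    have "H (F s) = F (H s)" for s
      using lifts_not_less_commute[OF rec L(1) F(2) L(2) H(2), of s]
        lifts_not_less_commute[OF rec L(2) H(2) L(1) F(2), of s] by simp
    then have "lift (h \<otimes>\<^bsub>M\<^esub> g) (\<lambda>s. F (H s))" using lift_mult[OF h g H(1) F(1)] by simp
    then show ?thesis using g h lift_mult[OF g h F(1) H(1)] by (intro mem_eqI) auto
  qed
  have "finite (generate M S)"
    using fin_S S_subset subset comm torsion
    by (intro M.finite_generate_torsion_commute) (auto simp: gen_S)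
  then show ?thesis by (simp only: gen_S)
qed

end

subsection \<open>Recurrence and wandering sets\<close>

lemma finite_superlevel_if_bounded_sums:
  fixes w :: "'a \<Rightarrow> real"
  assumes sum: "\<And>H. finite H \<Longrightarrow> H \<subseteq> A \<Longrightarrow> sum w H \<le> T" and c: "c > 0"
  shows "finite {x \<in> A. w x \<ge> c}"
proof (rule ccontr)
  assume inf: "infinite {x \<in> A. w x \<ge> c}"
  obtain H where H: "H \<subseteq> {x \<in> A. w x \<ge> c}" "finite H" "card H = nat \<lceil>T / c\<rceil> + 1"
    using infinite_arbitrarily_large[OF inf] by metis
  have "real (card H) * c \<le> sum w H"
    using H(1) by (intro sum_bounded_below) auto
  also have "\<dots> \<le> T" using H by (intro sum) auto
  finally have "real (card H) \<le> T / c" using c by (simp add: pos_le_divide_eq)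
  then show False unfolding H(3) by linarith
qed

context circle_group
begin

text \<open>\<open>w\<close> stands for the derivative at the point in the given metric, which
  differs from the arc length derivative by bounded factors. The lower comparison transfers sums for
  positive \<delta>, the upper one transfers finiteness of sublevel sets for negative
  \<delta>.\<close>

lemma no_summable_recurrent_exponent:
  fixes w :: "(complex \<Rightarrow> complex) \<Rightarrow> real"
  assumes \<delta>: "\<delta> \<le> 1"
    and sum: "\<And>H. finite H \<Longrightarrow> H \<subseteq> G \<Longrightarrow> (\<Sum>h\<in>H. w h powr \<delta>) \<le> T"
    and c: "c > 0" and lower: "\<And>g. g \<in> G \<Longrightarrow> c * angular_deriv g (cis t0) \<le> w g"
    and upper: "\<And>g. g \<in> G \<Longrightarrow> w g \<le> C * angular_deriv g (cis t0)"
    and rec: "\<And>\<epsilon>. \<epsilon> > 0 \<Longrightarrow> infinite {g \<in> G. \<exists>F. lift g F \<and> \<bar>F t0 - t0\<bar> < \<epsilon>}"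
  shows False
proof -
  let ?a = "\<lambda>g. angular_deriv g (cis t0)"
  have wpos: "w g > 0" if "g \<in> G" for g
    using lower[OF that] mult_pos_pos[OF c ad_cis_pos[OF that, of t0]] by linarith
  have level: "finite {g \<in> G. w g powr \<delta> \<ge> d}" if "d > 0" for d
    using sum that by (rule finite_superlevel_if_bounded_sums)
  have infG: "infinite G"
  proof
    assume "finite G"
    then have "finite {g \<in> G. \<exists>F. lift g F \<and> \<bar>F t0 - t0\<bar> < 1}" by simp
    then show False using rec[of 1] by simp
  qed
  consider "\<delta> > 0" | "\<delta> = 0" | "\<delta> < 0" by linarith
  then show False
  proof cases
    case 1
    define P where "P = {g \<in> G. w g powr \<delta> \<ge> 1}"
    have P: "finite P" unfolding P_def by (rule level) simp
    have small: "w g \<le> w g powr \<delta>" if "g \<in> G - P" for g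
    proof -
      from that have g: "g \<in> G" "w g powr \<delta> < 1" by (auto simp: P_def)
      have "w g \<le> 1"
      proof (rule ccontr)
        assume "\<not> w g \<le> 1"
        then have "w g powr \<delta> \<ge> 1" using 1 by (intro ge_one_powr_ge_zero) auto
        with g show False by simp
      qed
      then have "w g powr 1 \<le> w g powr \<delta>" using \<delta> wpos[OF g(1)] by (intro powr_mono') auto
      then show ?thesis using wpos[OF g(1)] by simp
    qed
    have bound: "(\<Sum>h\<in>H. ?a h) \<le> (sum w P + T) / c" if H: "finite H" "H \<subseteq> G" for H
    proof -
      have "c * (\<Sum>h\<in>H. ?a h) = (\<Sum>h\<in>H. c * ?a h)" by (rule sum_distrib_left)
      also have "\<dots> \<le> sum w H" using lower H by (intro sum_mono) auto
      also have "\<dots> = sum w (H \<inter> P) + sum w (H - P)" using H by (simp add: sum.Int_Diff)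
      also have "sum w (H \<inter> P) \<le> sum w P"
        using P wpos by (intro sum_mono2) (auto simp: P_def less_imp_le)
      also have "sum w (H - P) \<le> (\<Sum>h\<in>H - P. w h powr \<delta>)"
        using H small by (intro sum_mono) auto
      also have "\<dots> \<le> T" using H by (intro sum) auto
      finally have "c * (\<Sum>h\<in>H. ?a h) \<le> sum w P + T" by simp
      then show ?thesis using c by (simp add: pos_le_divide_eq mult.commute)
    qed
    show False by (rule not_summable_recurrent[OF bound rec])
  next
    case 2
    \<comment> \<open>All terms equal 1 because \<open>powr 0\<close> gives 1 on positive
      numbers.\<close>
    have "{g \<in> G. w g powr \<delta> \<ge> 1} = G" using wpos 2 by fastforce
    with level[of 1] infG show False by simp
  next
    case 3
    have fin: "finite {g \<in> G. ?a g \<le> d}" for d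
    proof (rule finite_subset)
      \<comment> \<open>The maximum with 1 keeps \<open>e\<close> positive for every
        \<open>d\<close>, so that \<open>e powr \<delta>\<close> is a positive level.\<close>
      define e where "e = max 1 (C * d)"
      have Cpos: "C > 0"
        using wpos[OF one_closed] upper[OF one_closed] by (simp add: ad_one)
      show "{g \<in> G. ?a g \<le> d} \<subseteq> {g \<in> G. w g powr \<delta> \<ge> e powr \<delta>}"
      proof
        fix g assume "g \<in> {g \<in> G. ?a g \<le> d}"
        then have g: "g \<in> G" "?a g \<le> d" by auto
        have "w g \<le> C * ?a g" by (rule upper[OF g(1)])
        also have "\<dots> \<le> C * d" using g(2) Cpos by (intro mult_left_mono) auto
        finally have "w g \<le> e" by (simp add: e_def)
        then have "e powr \<delta> \<le> w g powr \<delta>"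
          using 3 wpos[OF g(1)] by (intro powr_mono2') auto
        with g show "g \<in> {g \<in> G. w g powr \<delta> \<ge> e powr \<delta>}" by simp
      qed
      have "e powr \<delta> > 0" by (simp add: e_def)
      then show "finite {g \<in> G. w g powr \<delta> \<ge> e powr \<delta>}" by (rule level)
    qed
    have tors: "\<exists>n>0. g [^]\<^bsub>M\<^esub> (n::nat) = \<one>\<^bsub>M\<^esub>" if g: "g \<in> G" for g
    proof (rule ccontr)
      assume "\<not> ?thesis"
      then have inj: "inj (\<lambda>k::int. g [^]\<^bsub>M\<^esub> k)"
        by (intro M.inj_int_pow carrierI[OF g]) blast
      show False
      proof (rule not_expanding_powers[OF g])
        fix d
        have "{k. dpow g t0 k \<le> d} = (\<lambda>k::int. g [^]\<^bsub>M\<^esub> k) -` {g \<in> G. ?a g \<le> d}"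
          using int_pow_mem[OF g] by auto
        then show "finite {k. dpow g t0 k \<le> d}" using finite_vimageI[OF fin inj] by simp
      qed
    qed
    interpret torsion_circle_group G S by unfold_locales (rule tors)
    from finite_if_recurrent[OF rec] infG show False by simp
  qed
qed

section \<open>Recurrence in minimal sets\<close>

lemma continuous_on_circle: "g \<in> G \<Longrightarrow> continuous_on unit_circle g"
proof (rule continuous_on_circleI)
  assume g: "g \<in> G"
  obtain F where F: "lift g F" using lift_ex[OF g] by blast
  have "continuous_on UNIV F"
    using lift_isCont[OF F] by (simp add: continuous_on_eq_continuous_at)
  then show "continuous_on UNIV (\<lambda>t. g (cis t))"
    unfolding lift_cis[OF F] by (intro continuous_intros)
qed

text \<open>One inclusion suffices, since the inverse of each element also maps \<open>K\<close>
  into itself.\<close>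

lemma closed_invariantI:
  assumes "K \<noteq> {}" "K \<subseteq> unit_circle" "closed K" and inv: "\<And>g z. g \<in> G \<Longrightarrow> z \<in> K \<Longrightarrow> g z \<in> K"
  shows "closed_invariant G K"
  unfolding closed_invariant_def
proof (intro conjI ballI assms(1-3) equalityI subsetI)
  fix g z assume g: "g \<in> G"
  show "z \<in> K" if "z \<in> g ` K" using that inv[OF g] by blast
  show "z \<in> g ` K" if z: "z \<in> K"
  proof
    show "z = g ((inv\<^bsub>M\<^esub> g) z)" using apply_inv[OF g] assms(2) z by auto
    show "(inv\<^bsub>M\<^esub> g) z \<in> K" by (rule inv[OF m_inv_closed[OF g] z])
  qed
qed

text \<open>The limit points of \<Lambda> form a closed invariant set, nonempty because \<Lambda> is
  infinite and compact, so minimality makes \<open>cis t0\<close> a limit point of \<Lambda>.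
  Minimality also makes its orbit dense in \<Lambda>, hence \<open>cis t0\<close> is a limit point
  of its orbit, and infinitely many nearby orbit points come from infinitely many elements.\<close>

lemma minimal_imp_recurrent:
  assumes min: "minimal_invariant G \<Lambda>" and inf: "infinite \<Lambda>" and x: "cis t0 \<in> \<Lambda>" and "\<epsilon> > 0"
  shows "infinite {g \<in> G. \<exists>F. lift g F \<and> \<bar>F t0 - t0\<bar> < \<epsilon>}"
proof -
  have \<Lambda>: "\<Lambda> \<subseteq> unit_circle" "closed \<Lambda>" "\<And>g. g \<in> G \<Longrightarrow> g ` \<Lambda> = \<Lambda>"
    and minD: "\<And>K. closed_invariant G K \<Longrightarrow> K \<subseteq> \<Lambda> \<Longrightarrow> K = \<Lambda>"
    using min unfolding minimal_invariant_def closed_invariant_def by blast+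
  have "compact \<Lambda>" using \<Lambda>(1,2) by (meson bounded_sphere bounded_subset compact_eq_bounded_closed)
  define D where "D = {z. z islimpt \<Lambda>}"
  have D_sub: "D \<subseteq> \<Lambda>" using \<Lambda>(2) unfolding D_def closed_limpt by blast
  have "closed_invariant G D"
  proof (rule closed_invariantI)
    show "D \<noteq> {}"
      using Heine_Borel_imp_Bolzano_Weierstrass[OF \<open>compact \<Lambda>\<close> inf order_refl] unfolding D_def by blast
    show "D \<subseteq> unit_circle" using D_sub \<Lambda>(1) by blast
    show "closed D" unfolding D_def by (rule closed_limpts)
    fix g z assume g: "g \<in> G" and z: "z \<in> D"
    have zc: "z \<in> unit_circle" using z D_sub \<Lambda>(1) by blast
    show "g z \<in> D"
      unfolding D_def mem_Collect_eq islimpt_approachable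
    proof (intro allI impI)
      fix e :: real assume "e > 0"
      then obtain d where d: "d > 0" "\<And>y. y \<in> unit_circle \<Longrightarrow> dist y z < d \<Longrightarrow> dist (g y) (g z) < e"
        using continuous_on_circle[OF g] zc unfolding continuous_on_iff by blast
      obtain y where y: "y \<in> \<Lambda>" "y \<noteq> z" "dist y z < d"
        using z d(1) unfolding D_def mem_Collect_eq islimpt_approachable by blast
      have yc: "y \<in> unit_circle" using y(1) \<Lambda>(1) by blast
      have "g y \<in> \<Lambda>" using \<Lambda>(3)[OF g] y(1) by blast
      moreover have "g y \<noteq> g z" using inj_onD[OF inj[OF g] _ yc zc] y(2) by blast
      ultimately show "\<exists>x'\<in>\<Lambda>. x' \<noteq> g z \<and> dist x' (g z) < e" using d(2)[OF yc y(3)] by blast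
    qed
  qed
  from minD[OF this D_sub] x have lim: "cis t0 islimpt \<Lambda>" unfolding D_def by blast
  define orb where "orb = (\<lambda>g. g (cis t0)) ` G"
  have orb: "orb \<subseteq> \<Lambda>" using \<Lambda>(3) x unfolding orb_def by blast
  have cl: "closure orb \<subseteq> \<Lambda>" using orb \<Lambda>(2) by (rule closure_minimal)
  have "closed_invariant G (closure orb)"
  proof (rule closed_invariantI)
    have "G \<noteq> {}" using one_closed by blast
    then show "closure orb \<noteq> {}" unfolding orb_def by simp
    show "closure orb \<subseteq> unit_circle" using cl \<Lambda>(1) by blast
    fix g z assume g: "g \<in> G" and z: "z \<in> closure orb"
    have "g ` closure orb \<subseteq> closure orb"
    proof (rule image_closure_subset)
      show "continuous_on (closure orb) g"
        using cl \<Lambda>(1) by (intro continuous_on_subset[OF continuous_on_circle[OF g]]) blast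
      have "g ` orb \<subseteq> orb"
      proof
        fix y assume "y \<in> g ` orb"
        then obtain h where h: "h \<in> G" "y = g (h (cis t0))" unfolding orb_def by blast
        then have "y = (g \<otimes>\<^bsub>M\<^esub> h) (cis t0)" using mult_apply[OF g h(1), of "cis t0"] by simp
        then show "y \<in> orb" unfolding orb_def using m_closed[OF g h(1)] by blast
      qed
      then show "g ` orb \<subseteq> closure orb" using closure_subset by blast
    qed simp
    with z show "g z \<in> closure orb" by blast
  qed simp
  from minD[OF this cl] lim have "cis t0 islimpt closure orb" by simp
  then have lim': "cis t0 islimpt orb" by (simp add: limpt_of_closure)
  obtain \<eta> where \<eta>: "\<eta> > 0" "\<And>a b. dist (cis a) (cis b) < \<eta> \<Longrightarrow> \<exists>n::int. \<bar>a + 2 * pi * n - b\<bar> < \<epsilon>"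
    using cis_near_imp_near[OF \<open>\<epsilon> > 0\<close>] by blast
  let ?R = "{g \<in> G. \<exists>F. lift g F \<and> \<bar>F t0 - t0\<bar> < \<epsilon>}"
  have "orb \<inter> ball (cis t0) \<eta> \<subseteq> (\<lambda>g. g (cis t0)) ` ?R"
  proof
    fix y assume "y \<in> orb \<inter> ball (cis t0) \<eta>"
    then obtain g where g: "g \<in> G" "y = g (cis t0)" and d: "dist (cis t0) y < \<eta>"
      unfolding orb_def by auto
    obtain F where F: "lift g F" using lift_ex[OF g(1)] by blast
    have "dist (cis (F t0)) (cis t0) < \<eta>" using d g(2) lift_cis[OF F] by (simp add: dist_commute)
    from \<eta>(2)[OF this] obtain n :: int where "\<bar>F t0 + 2 * pi * n - t0\<bar> < \<epsilon>" by blast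
    then have "g \<in> ?R" using g(1) lift_shift[OF F, of n] by blast
    then show "y \<in> (\<lambda>g. g (cis t0)) ` ?R" using g(2) by blast
  qed
  moreover have "infinite (orb \<inter> ball (cis t0) \<eta>)"
    using lim' \<eta>(1) unfolding islimpt_eq_infinite_ball by blast
  ultimately show ?thesis using finite_subset finite_imageI by blast
qed


section \<open>Summability from a wandering set\<close>

lemma continuous_metric: "riemannian_metric \<rho> \<Longrightarrow> continuous_on unit_circle \<rho>"
  unfolding riemannian_metric_def circle_C_k_def using C_k.simps(1) continuous_on_circleI by blast

lemma continuous_metric_deriv:
  assumes \<rho>: "riemannian_metric \<rho>" and g: "g \<in> G"
  shows "continuous_on unit_circle (metric_deriv \<rho> g)"
proof -
  have "continuous_on unit_circle (\<lambda>z. \<rho> (g z))"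
    by (rule continuous_on_compose2[OF continuous_metric[OF \<rho>] continuous_on_circle[OF g]])
      (use maps[OF g] in auto)
  moreover have "continuous_on unit_circle (angular_deriv g)"
    by (rule continuous_on_circleI[OF continuous_angular_deriv_cis[OF C1[OF g] maps[OF g]]])
  moreover have "\<forall>z\<in>unit_circle. \<rho> z \<noteq> 0"
    using \<rho> unfolding riemannian_metric_def by force
  ultimately show ?thesis
    unfolding metric_deriv_def[abs_def] by (intro continuous_intros continuous_metric[OF \<rho>]) auto
qed

text \<open>The image under \<open>g\<close> is the preimage under its inverse, which is
  continuous.\<close>

lemma image_in_sets:
  assumes \<mu>: "sets \<mu> = sets (restrict_space borel unit_circle)" and g: "g \<in> G" and B: "B \<in> sets \<mu>"
  shows "g ` B \<in> sets \<mu>"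
proof -
  let ?R = "restrict_space borel unit_circle :: complex measure"
  let ?i = "inv\<^bsub>M\<^esub> g"
  have i: "?i \<in> G" using g by simp
  have sp: "space ?R = unit_circle" by (simp add: space_restrict_space)
  have "?i \<in> measurable ?R borel"
    by (rule borel_measurable_continuous_on_restrict[OF continuous_on_circle[OF i]])
  then have "?i \<in> measurable ?R ?R"
    by (rule measurable_restrict_space2[rotated]) (use maps[OF i] sp in auto)
  then have "?i -` B \<inter> space ?R \<in> sets ?R"
    using B \<mu> by (intro measurable_sets) auto
  moreover have "?i -` B \<inter> unit_circle = g ` B"
  proof (intro equalityI subsetI)
    have Bsub: "B \<subseteq> unit_circle" using sets.sets_into_space[of B ?R] B \<mu> sp by auto
    fix z
    show "z \<in> g ` B" if "z \<in> ?i -` B \<inter> unit_circle"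
      using that apply_inv[OF g, of z] by (intro image_eqI[of _ _ "?i z"]) auto
    show "z \<in> ?i -` B \<inter> unit_circle" if "z \<in> g ` B"
    proof -
      from that obtain y where y: "y \<in> B" "z = g y" by blast
      then have "y \<in> unit_circle" using Bsub by blast
      then show ?thesis using y inv_apply[OF g] funcset_mem[OF maps[OF g]] by auto
    qed
  qed
  ultimately show ?thesis using \<mu> sp by simp
qed

lemma disjoint_translates:
  assumes g: "g \<in> G" and h: "h \<in> G" and gh: "g \<noteq> h" and B: "B \<subseteq> unit_circle"
    and disj: "\<And>k. k \<in> G - {\<one>\<^bsub>M\<^esub>} \<Longrightarrow> B \<inter> k ` B = {}"
  shows "g ` B \<inter> h ` B = {}"
proof (rule ccontr)
  assume "\<not> ?thesis"
  then obtain y z where y: "y \<in> B" and z: "z \<in> B" and eq: "g y = h z" by blast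
  let ?k = "inv\<^bsub>M\<^esub> g \<otimes>\<^bsub>M\<^esub> h"
  have yz: "y \<in> unit_circle" "z \<in> unit_circle" using y z B by auto
  have "?k z = (inv\<^bsub>M\<^esub> g) (g y)" using mult_apply[OF m_inv_closed[OF g] h yz(2)] eq by simp
  then have kz: "?k z = y" using inv_apply[OF g yz(1)] by simp
  have "?k \<noteq> \<one>\<^bsub>M\<^esub>"
  proof
    assume "?k = \<one>\<^bsub>M\<^esub>"
    then have "h = g"
      using M.inv_solve_left[of "\<one>\<^bsub>M\<^esub>" g h] carrierI[OF g] carrierI[OF h] by simp
    with gh show False by simp
  qed
  then have "B \<inter> ?k ` B = {}" using g h by (intro disj) simp
  with kz y z show False by blast
qed

text \<open>The translates of a wandering set have total measure at most 1, and conformality turns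
  this total into the integral over the set of the series of derivatives. The series is finite
  almost everywhere there, in particular at some point of \<Lambda>.\<close>

lemma dissipative_point:
  assumes \<rho>: "riemannian_metric \<rho>" and conf: "conformal_measure \<rho> G \<delta> \<mu>"
    and supp: "emeasure \<mu> (unit_circle - \<Lambda>) = 0" and \<Lambda>: "closed \<Lambda>"
    and infG: "infinite G" and dis: "\<not> conservative G \<mu>"
  shows "\<exists>x\<in>unit_circle \<inter> \<Lambda>. \<exists>T. \<forall>H. finite H \<longrightarrow> H \<subseteq> G \<longrightarrow> (\<Sum>h\<in>H. metric_deriv \<rho> h x powr \<delta>) \<le> T"
proof -
  let ?R = "restrict_space borel unit_circle :: complex measure"
  have prob: "prob_space \<mu>" and sets: "sets \<mu> = sets ?R"
    and conf: "\<And>g B. g \<in> G \<Longrightarrow> B \<in> sets \<mu> \<Longrightarrow>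
        emeasure \<mu> (g ` B) = (\<integral>\<^sup>+x\<in>B. ennreal (metric_deriv \<rho> g x powr \<delta>) \<partial>\<mu>)"
    using conf unfolding conformal_measure_def circle_probability_def by blast+
  interpret prob_space \<mu> by (rule prob)
  have sp: "space \<mu> = unit_circle" using sets_eq_imp_space_eq[OF sets] by (simp add: space_restrict_space)
  obtain A where A: "A \<in> sets \<mu>" "emeasure \<mu> A > 0"
    and wander: "\<And>g. g \<in> G - {\<one>\<^bsub>M\<^esub>} \<Longrightarrow> emeasure \<mu> (A \<inter> g ` A) = 0"
    using dis unfolding conservative_def by (metis not_gr_zero)
  \<comment> \<open>Failure of conservativity gives overlaps of measure 0 only. Since
    \<open>G\<close> is countable, all of them can be removed at once, which makes the translates of
    the remainder genuinely disjoint.\<close>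
  define N where "N = (\<Union>g\<in>G - {\<one>\<^bsub>M\<^esub>}. A \<inter> g ` A)"
  have N: "N \<in> null_sets \<mu>"
    unfolding N_def
  proof (rule null_sets_UN')
    show "countable (G - {\<one>\<^bsub>M\<^esub>})" using countable_G by simp
    fix g assume "g \<in> G - {\<one>\<^bsub>M\<^esub>}"
    then show "A \<inter> g ` A \<in> null_sets \<mu>"
      using wander image_in_sets[OF sets _ A(1)] A(1) by (intro null_setsI) auto
  qed
  define B where "B = A - N"
  have B: "B \<in> sets \<mu>" unfolding B_def using A(1) N by auto
  have Bpos: "emeasure \<mu> B > 0"
    unfolding B_def using emeasure_Diff_null_set[OF N A(1)] A(2) by simp
  have Bsub: "B \<subseteq> unit_circle" using sets.sets_into_space[OF B] sp by simp
  have Bdisj: "B \<inter> k ` B = {}" if "k \<in> G - {\<one>\<^bsub>M\<^esub>}" for k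
    using that unfolding B_def N_def by blast
  define \<gamma> where "\<gamma> = from_nat_into G"
  have \<gamma>: "bij_betw \<gamma> UNIV G"
    unfolding \<gamma>_def by (rule bij_betw_from_nat_into[OF countable_G infG])
  have \<gamma>G: "\<gamma> n \<in> G" for n using \<gamma> by (auto simp: bij_betw_def)
  have "disjoint_family (\<lambda>n. \<gamma> n ` B)"
    unfolding disjoint_family_on_def
  proof (intro ballI impI)
    fix m n :: nat assume "m \<noteq> n"
    then have "\<gamma> m \<noteq> \<gamma> n" using \<gamma> by (auto simp: bij_betw_def inj_def)
    then show "\<gamma> m ` B \<inter> \<gamma> n ` B = {}"
      by (rule disjoint_translates[OF \<gamma>G \<gamma>G _ Bsub Bdisj])
  qed
  then have "(\<Sum>n. emeasure \<mu> (\<gamma> n ` B)) = emeasure \<mu> (\<Union>n. \<gamma> n ` B)"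
    by (intro suminf_emeasure) (auto intro: image_in_sets[OF sets \<gamma>G B])
  also have "\<dots> \<le> 1" by (rule emeasure_le_1)
  finally have le1: "(\<Sum>n. emeasure \<mu> (\<gamma> n ` B)) \<le> 1" .
  define f where "f n x = ennreal (metric_deriv \<rho> (\<gamma> n) x powr \<delta>) * indicator B x" for n x
  have f: "f n \<in> borel_measurable \<mu>" for n
  proof -
    have "metric_deriv \<rho> (\<gamma> n) \<in> borel_measurable ?R"
      by (rule borel_measurable_continuous_on_restrict[OF continuous_metric_deriv[OF \<rho> \<gamma>G]])
    then have "metric_deriv \<rho> (\<gamma> n) \<in> borel_measurable \<mu>"
      by (simp only: measurable_cong_sets[OF sets refl])
    then show ?thesis unfolding f_def using B by measurable
  qed
  have "(\<integral>\<^sup>+x. (\<Sum>n. f n x) \<partial>\<mu>) = (\<Sum>n. \<integral>\<^sup>+x. f n x \<partial>\<mu>)"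
    by (rule nn_integral_suminf[OF f])
  also have "\<dots> = (\<Sum>n. emeasure \<mu> (\<gamma> n ` B))"
    unfolding f_def by (intro suminf_cong conf[OF \<gamma>G B, symmetric])
  finally have "(\<integral>\<^sup>+x. (\<Sum>n. f n x) \<partial>\<mu>) \<noteq> \<infinity>" using le1 by (auto simp: top_unique)
  then have AE1: "AE x in \<mu>. (\<Sum>n. f n x) \<noteq> \<infinity>"
    using f by (intro nn_integral_PInf_AE borel_measurable_suminf_order)
  have "\<Lambda> \<inter> unit_circle \<in> sets ?R" using \<Lambda> by (auto simp: sets_restrict_space)
  then have "unit_circle - (\<Lambda> \<inter> unit_circle) \<in> sets \<mu>"
    using sets.Diff[OF sets.top[of \<mu>], of "\<Lambda> \<inter> unit_circle"] sets sp by simp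
  moreover have "unit_circle - (\<Lambda> \<inter> unit_circle) = unit_circle - \<Lambda>" by blast
  ultimately have "unit_circle - \<Lambda> \<in> null_sets \<mu>" using supp by (intro null_setsI) auto
  then have AE2: "AE x in \<mu>. x \<notin> unit_circle - \<Lambda>" by (rule AE_not_in)
  have "\<exists>x\<in>B. (\<Sum>n. f n x) \<noteq> \<infinity> \<and> x \<in> \<Lambda>"
  proof (rule ccontr)
    assume c: "\<not> ?thesis"
    have "AE x in \<mu>. x \<notin> B"
      using AE1 AE2 by eventually_elim (use c Bsub in blast)
    then have "B \<in> null_sets \<mu>" using AE_iff_null_sets[OF B] by simp
    with Bpos show False by (simp add: null_sets_def)
  qed
  then obtain x where x: "x \<in> B" "(\<Sum>n. f n x) \<noteq> \<infinity>" "x \<in> \<Lambda>" by blast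
  let ?w = "\<lambda>g. metric_deriv \<rho> g x powr \<delta>"
  have "(\<Sum>h\<in>H. ?w h) \<le> enn2real (\<Sum>n. f n x)" if H: "finite H" "H \<subseteq> G" for H
  proof -
    define J where "J = \<gamma> -` H"
    have J: "finite J" unfolding J_def using \<gamma> H(1) by (intro finite_vimageI) (auto simp: bij_betw_def)
    have HJ: "H = \<gamma> ` J" unfolding J_def using \<gamma> H(2) by (auto simp: bij_betw_def)
    have "ennreal (\<Sum>h\<in>H. ?w h) = (\<Sum>h\<in>H. ennreal (?w h))" by (rule sum_ennreal[symmetric]) simp
    also have "\<dots> = (\<Sum>n\<in>J. ennreal (?w (\<gamma> n)))"
      unfolding HJ using \<gamma> by (intro sum.reindex_cong[of \<gamma>]) (auto simp: bij_betw_def inj_on_def inj_def)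
    also have "\<dots> = (\<Sum>n\<in>J. f n x)" using x(1) by (simp add: f_def)
    also have "\<dots> \<le> (\<Sum>n. f n x)" using J by (intro sum_le_suminf) auto
    also have "\<dots> = ennreal (enn2real (\<Sum>n. f n x))" using x(2) by (simp add: less_top)
    finally show ?thesis by (simp add: ennreal_le_iff)
  qed
  then show ?thesis using x Bsub by blast
qed

end

theorem theorem5:
  fixes G :: "(complex \<Rightarrow> complex) set" and \<rho> :: "complex \<Rightarrow> real"
    and \<delta> :: real and \<mu> :: "complex measure" and \<Lambda> :: "complex set"
  assumes "riemannian_metric \<rho>"
    and "C2_diffeo_group G"
    and "finitely_generated G"
    and "\<delta> \<le> 1"
    and "conformal_measure \<rho> G \<delta> \<mu>"
    and "no_atoms \<mu>"
    and "minimal_invariant G \<Lambda>"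
    and "infinite \<Lambda>"
    and "supported_on \<mu> \<Lambda>"
  shows "conservative G \<mu>"
proof (rule ccontr)
  assume dis: "\<not> conservative G \<mu>"
  obtain S where S: "finite S" "S \<subseteq> G" "generate (BijGroup unit_circle) S = G"
    using assms(3) unfolding finitely_generated_def by blast
  interpret circle_group G S
    using assms(2) S by unfold_locales
  note \<rho> = assms(1)
  have \<Lambda>: "\<Lambda> \<noteq> {}" "\<Lambda> \<subseteq> unit_circle" "closed \<Lambda>"
    using assms(7) unfolding minimal_invariant_def closed_invariant_def by blast+
  \<comment> \<open>Recurrence at any single point of \<Lambda> already produces infinitely many
    elements.\<close>
  have infG: "infinite G"
  proof
    assume fin: "finite G"
    obtain y where y: "y \<in> \<Lambda>" using \<Lambda>(1) by blast
    then obtain s where "y = cis s" using \<Lambda>(2) unit_circle_cis by blast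
    with y have "infinite {g \<in> G. \<exists>F. lift g F \<and> \<bar>F s - s\<bar> < 1}"
      by (intro minimal_imp_recurrent[OF assms(7,8)]) auto
    moreover have "finite {g \<in> G. \<exists>F. lift g F \<and> \<bar>F s - s\<bar> < 1}" using fin by simp
    ultimately show False by simp
  qed
  obtain x T where x: "x \<in> unit_circle" "x \<in> \<Lambda>"
    and T: "\<And>H. finite H \<Longrightarrow> H \<subseteq> G \<Longrightarrow> (\<Sum>h\<in>H. metric_deriv \<rho> h x powr \<delta>) \<le> T"
    using dissipative_point[OF \<rho> assms(5) assms(9)[unfolded supported_on_def] \<Lambda>(3) infG dis] by blast
  obtain t where t: "x = cis t" using x(1) unit_circle_cis by blast
  have ne: "unit_circle \<noteq> {}" using x(1) by blast
  have comp: "compact unit_circle" by (rule compact_sphere)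
  \<comment> \<open>The extrema of \<rho> over the compact circle, divided by
    \<open>\<rho> x\<close>, are the constants comparing the two derivatives at \<open>x\<close>,
    uniformly in the image point \<open>g x\<close>.\<close>
  obtain l where l: "l \<in> unit_circle" "\<And>z. z \<in> unit_circle \<Longrightarrow> \<rho> l \<le> \<rho> z"
    using continuous_attains_inf[OF comp ne continuous_metric[OF \<rho>]] by blast
  obtain u where u: "u \<in> unit_circle" "\<And>z. z \<in> unit_circle \<Longrightarrow> \<rho> z \<le> \<rho> u"
    using continuous_attains_sup[OF comp ne continuous_metric[OF \<rho>]] by blast
  have pos: "\<rho> z > 0" if "z \<in> unit_circle" for z
    using \<rho> that unfolding riemannian_metric_def by blast
  have bounds: "\<rho> l / \<rho> x * angular_deriv g (cis t) \<le> metric_deriv \<rho> g x \<and>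
      metric_deriv \<rho> g x \<le> \<rho> u / \<rho> x * angular_deriv g (cis t)" if g: "g \<in> G" for g
  proof -
    have gx: "g x \<in> unit_circle" using funcset_mem[OF maps[OF g] x(1)] .
    have a: "angular_deriv g x / \<rho> x \<ge> 0"
      using ad_pos[OF g x(1)] pos[OF x(1)] by simp
    show ?thesis
      using mult_right_mono[OF l(2)[OF gx] a] mult_right_mono[OF u(2)[OF gx] a]
      by (simp add: metric_deriv_def t)
  qed
  show False
  proof (rule no_summable_recurrent_exponent[OF assms(4) T])
    show "\<rho> l / \<rho> x > 0" using pos[OF l(1)] pos[OF x(1)] by simp
    show "infinite {g \<in> G. \<exists>F. lift g F \<and> \<bar>F t - t\<bar> < \<epsilon>}" if "\<epsilon> > 0" for \<epsilon>
      using x(2) that unfolding t by (rule minimal_imp_recurrent[OF assms(7,8)])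
    show "\<rho> l / \<rho> x * angular_deriv g (cis t) \<le> metric_deriv \<rho> g x"
      "metric_deriv \<rho> g x \<le> \<rho> u / \<rho> x * angular_deriv g (cis t)" if "g \<in> G" for g
      using bounds[OF that] by auto
  qed
qed

end
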